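(* Let $\tau>0$, let $f:\mathbb R^n\times\mathbb R^n\to\mathbb R^n$ be continuous with $f(0,0)=0$, and let $d\ge0$ be an even integer. Suppose there exist functions $g\in\Xi_1^d$, $h,\hat h\in\Xi_2^d$ and $\hat g$ with $-\hat g\in\Xi_3^d$ such that, for all $x_1,x_2,x_3\in\mathbb R^n$ and $\theta,\omega\in[-\tau,0]$, $$\begin{aligned}\hat g(x_1,x_2,x_3,\theta)=\;&g(x_1,x_1,0)-g(x_1,x_2,-\tau)+\tau\,\nabla_1g(x_1,x_3,\theta)^Tf(x_1,x_2)-\tau\frac{\partial}{\partial\theta}g(x_1,x_3,\theta)\\&+\tau h(x_1,x_3,0,\theta)-\tau h(x_2,x_3,-\tau,\theta)+\tau h(x_3,x_1,\theta,0)-\tau h(x_3,x_2,\theta,-\tau),\end{aligned}$$ $$\hat h(x_1,x_2,\theta,\omega)=\frac{\partial}{\partial\theta}h(x_1,x_2,\theta,\omega)+\frac{\partial}{\partial\omega}h(x_1,x_2,\theta,\omega),$$ where $\nabla_1$ is the gradient with respect to the first vector argument. Then the time-delay system $\dot x(t)=f(x(t),x(t-\tau))$ is globally asymptotically stable.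
   Context: $\Sigma_s$ denotes the set of polynomials that are finite sums of squares of real polynomials (in all the variables involved, including $\theta$). $\Xi_1^d$: polynomials $g(x_1,x_2,\theta)$, $x_i\in\mathbb R^n$, of degree at most $d$ for which there exist a polynomial $t(x_1,\theta)$ of degree at most $d$ and $\alpha>0$ with $g(x_1,x_2,\theta)-t(x_1,\theta)-\alpha\|x_1\|^2\in\Sigma_s$ and $\int_{-\tau}^0t(x_1,\theta)\,d\theta=0$ for all $x_1$. $\Xi_3^d$: polynomials $q(x_1,x_2,x_3,\theta)$ of degree at most $d$ for which there exist a polynomial $t(x_1,x_2,\theta)$ of degree at most $d$ and $\alpha>0$ with $q(x_1,x_2,x_3,\theta)-t(x_1,x_2,\theta)-\alpha\|x_1\|^2\in\Sigma_s$ and $\int_{-\tau}^0t(x_1,x_2,\theta)\,d\theta=0$ for all $x_1,x_2$. $\Xi_2^{2m}$ (here $d=2m$): polynomials $h(x_1,x_2,\theta,\omega)$ of degree at most $2m$ of the form $h(x_1,x_2,\theta,\omega)=Z_m(x_1)^TR(\theta,\omega)Z_m(x_2)$, where $Z_m(x)$ is the vector of all $N=\binom{n+m}{m}$ monomials in $x\in\mathbb R^n$ of degree at most $m$, and $R(\theta,\omega)=\bar Z(\theta)^TQ_0\bar Z(\omega)$ with $\bar Z(\theta)=I_N\otimes(1,\theta,\dots,\theta^m)^T$ and $Q_0$ a positive semidefinite real symmetric matrix of size $N(m+1)$. $\mathcal C_\tau$ is the space of continuous functions $[-\tau,0]\to\mathbb R^n$ with supremum norm. It is assumed that for each $\phi\in\mathcal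 C_\tau$ the equation has a unique solution on $[-\tau,\infty)$ with $x=\phi$ on $[-\tau,0]$. Globally asymptotically stable means: every solution is bounded; for every $\varepsilon>0$ there is $\delta>0$ such that $\|\phi\|<\delta$ implies $\sup_{t\ge-\tau}\|x(t)\|<\varepsilon$; and every solution satisfies $\lim_{t\to\infty}x(t)=0$. *)

theory Defs
  imports "HOL-Analysis.Analysis"
begin

section \<open>Polynomials of bounded degree and sums of squares\<close>

text \<open>
  Real polynomials are represented by the functions they induce; over the reals the two notions
  coincide. The variables are the coordinates of a Euclidean space, typically a product such as
  \<open>(real^'n) \<times> (real^'n) \<times> real\<close>. A multi-index is a map from the standard basis to exponents,
  extended by \<open>undefined\<close> outside the basis.
\<close>

definition multi_indices :: "nat \<Rightarrow> ('a::euclidean_space \<Rightarrow> nat) set" where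
  "multi_indices m = {\<alpha> \<in> Basis \<rightarrow>\<^sub>E UNIV. (\<Sum>b\<in>Basis. \<alpha> b) \<le> m}"

definition monomial :: "('a::euclidean_space \<Rightarrow> nat) \<Rightarrow> 'a \<Rightarrow> real" where
  "monomial \<alpha> x = (\<Prod>b\<in>Basis. (x \<bullet> b) ^ \<alpha> b)"

definition poly_deg_le :: "nat \<Rightarrow> ('a::euclidean_space \<Rightarrow> real) \<Rightarrow> bool" where
  "poly_deg_le d p \<longleftrightarrow> (\<exists>c. \<forall>x. p x = (\<Sum>\<alpha>\<in>multi_indices d. c \<alpha> * monomial \<alpha> x))"

definition sos :: "('a::euclidean_space \<Rightarrow> real) set" where
  "sos = {p. \<exists>qs. (\<forall>q\<in>set qs. real_polynomial_function q) \<and> (\<forall>x. p x = (\<Sum>q\<leftarrow>qs. (q x)\<^sup>2))}"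

lemma finite_multi_indices: "finite (multi_indices m :: ('a::euclidean_space \<Rightarrow> nat) set)"
proof (rule finite_subset)
  show "multi_indices m \<subseteq> ((Basis :: 'a set) \<rightarrow>\<^sub>E {..m})"
  proof
    fix \<alpha> :: "'a \<Rightarrow> nat" assume a: "\<alpha> \<in> multi_indices m"
    have "\<alpha> b \<le> m" if "b \<in> Basis" for b
      using a member_le_sum[OF that, of \<alpha>] by (simp add: multi_indices_def)
    then show "\<alpha> \<in> Basis \<rightarrow>\<^sub>E {..m}"
      using a by (auto simp: multi_indices_def PiE_iff)
  qed
qed (simp add: finite_PiE)

lemma poly_deg_le_sum:
  assumes "finite A" "\<And>a. a \<in> A \<Longrightarrow> poly_deg_le d (f a)"
  shows "poly_deg_le d (\<lambda>x. \<Sum>a\<in>A. f a x)"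
proof -
  from assms(2) obtain c where
    c: "\<And>a x. a \<in> A \<Longrightarrow> f a x = (\<Sum>\<alpha>\<in>multi_indices d. c a \<alpha> * monomial \<alpha> x)"
    unfolding poly_deg_le_def by metis
  have "(\<Sum>a\<in>A. f a x) = (\<Sum>\<alpha>\<in>multi_indices d. (\<Sum>a\<in>A. c a \<alpha>) * monomial \<alpha> x)" for x
  proof -
    have "(\<Sum>a\<in>A. f a x) = (\<Sum>a\<in>A. \<Sum>\<alpha>\<in>multi_indices d. c a \<alpha> * monomial \<alpha> x)"
      by (rule sum.cong[OF refl]) (rule c)
    also have "\<dots> = (\<Sum>\<alpha>\<in>multi_indices d. \<Sum>a\<in>A. c a \<alpha> * monomial \<alpha> x)"
      by (rule sum.swap)
    finally show ?thesis by (simp only: sum_distrib_right)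
  qed
  then show ?thesis
    unfolding poly_deg_le_def by (intro exI[of _ "\<lambda>\<alpha>. \<Sum>a\<in>A. c a \<alpha>"] allI)
qed

lemma poly_deg_le_monomial:
  assumes "(\<Sum>b\<in>Basis. \<alpha> b) \<le> d"
  shows "poly_deg_le d (\<lambda>x. c * monomial \<alpha> x)"
proof -
  let ?\<beta> = "restrict \<alpha> Basis"
  have \<beta>: "?\<beta> \<in> multi_indices d"
    using assms by (simp add: multi_indices_def)
  have "monomial ?\<beta> x = monomial \<alpha> x" for x
    by (simp add: monomial_def)
  moreover have "(\<Sum>\<gamma>\<in>multi_indices d. (if \<gamma> = ?\<beta> then c else 0) * monomial \<gamma> x) = c * monomial ?\<beta> x" for x
    by (subst sum.remove[OF finite_multi_indices \<beta>]) simp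
  ultimately show ?thesis
    unfolding poly_deg_le_def by metis
qed

lemma poly_deg_le_mult:
  assumes "poly_deg_le d p" "poly_deg_le e q"
  shows "poly_deg_le (d + e) (\<lambda>x. p x * q x)"
proof -
  obtain a b where
    p: "\<And>x. p x = (\<Sum>\<alpha>\<in>multi_indices d. a \<alpha> * monomial \<alpha> x)" and
    q: "\<And>x. q x = (\<Sum>\<beta>\<in>multi_indices e. b \<beta> * monomial \<beta> x)"
    using assms unfolding poly_deg_le_def by metis
  have "p x * q x = (\<Sum>\<alpha>\<in>multi_indices d. \<Sum>\<beta>\<in>multi_indices e.
      (a \<alpha> * b \<beta>) * monomial (\<lambda>i. \<alpha> i + \<beta> i) x)" for x
    by (simp add: p q sum_product monomial_def power_add prod.distrib mult_ac)
  moreover have "poly_deg_le (d + e) (\<lambda>x. \<Sum>\<alpha>\<in>multi_indices d. \<Sum>\<beta>\<in>multi_indices e.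
      (a \<alpha> * b \<beta>) * monomial (\<lambda>i. \<alpha> i + \<beta> i) x)"
    by (intro poly_deg_le_sum poly_deg_le_monomial finite_multi_indices)
      (auto simp: multi_indices_def sum.distrib intro: add_mono)
  ultimately show ?thesis by simp
qed

lemma poly_deg_le_mono:
  assumes "poly_deg_le d p" "d \<le> e"
  shows "poly_deg_le e p"
proof -
  obtain c where c: "\<And>x. p x = (\<Sum>\<alpha>\<in>multi_indices d. c \<alpha> * monomial \<alpha> x)"
    using assms unfolding poly_deg_le_def by metis
  have "poly_deg_le e (\<lambda>x. \<Sum>\<alpha>\<in>multi_indices d. c \<alpha> * monomial \<alpha> x)"
    using assms(2)
    by (intro poly_deg_le_sum poly_deg_le_monomial finite_multi_indices)
      (auto simp: multi_indices_def)
  moreover have "p = (\<lambda>x. \<Sum>\<alpha>\<in>multi_indices d. c \<alpha> * monomial \<alpha> x)"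
    by (rule ext) (rule c)
  ultimately show ?thesis by (rule back_subst[of "poly_deg_le e", OF _ sym])
qed

lemma real_polynomial_function_iff_deg:
  "real_polynomial_function p \<longleftrightarrow> (\<exists>d. poly_deg_le d p)"
proof
  assume "real_polynomial_function p"
  then show "\<exists>d. poly_deg_le d p"
  proof induction
    case (linear f)
    interpret bounded_linear f by fact
    have "f x = (\<Sum>b\<in>Basis. f b * monomial (\<lambda>i. if i = b then 1 else 0) x)" for x
    proof -
      have "f x = f (\<Sum>b\<in>Basis. (x \<bullet> b) *\<^sub>R b)" by (simp add: euclidean_representation)
      also have "\<dots> = (\<Sum>b\<in>Basis. (x \<bullet> b) * f b)" by (simp add: sum scaleR)
      also have "\<dots> = (\<Sum>b\<in>Basis. f b * monomial (\<lambda>i. if i = b then 1 else 0) x)"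
      proof (rule sum.cong)
        fix b :: 'a assume b: "b \<in> Basis"
        have "monomial (\<lambda>i. if i = b then 1 else 0) x = x \<bullet> b"
          unfolding monomial_def by (subst prod.remove[OF _ b]) (auto intro!: prod.neutral)
        then show "(x \<bullet> b) * f b = f b * monomial (\<lambda>i. if i = b then 1 else 0) x" by simp
      qed simp
      finally show ?thesis .
    qed
    then have "f = (\<lambda>x. \<Sum>b\<in>Basis. f b * monomial (\<lambda>i. if i = b then 1 else 0) x)"
      by (rule ext)
    moreover have "poly_deg_le 1 (\<lambda>x. \<Sum>b\<in>Basis. f b * monomial (\<lambda>i. if i = b then 1 else 0) x)"
      by (intro poly_deg_le_sum poly_deg_le_monomial) auto
    ultimately have "poly_deg_le 1 f"
      by (rule ssubst[where P = "poly_deg_le 1"])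
    then show ?case ..
  next
    case (const c)
    have "poly_deg_le 0 (\<lambda>x::'a. c * monomial (\<lambda>_. 0) x)"
      by (intro poly_deg_le_monomial) auto
    then show ?case by (auto simp: monomial_def)
  next
    case (add f g)
    then obtain d e where "poly_deg_le d f" "poly_deg_le e g" by blast
    then have *: "poly_deg_le (max d e) f" "poly_deg_le (max d e) g"
      by (auto intro: poly_deg_le_mono)
    have "poly_deg_le (max d e) (\<lambda>x. \<Sum>i\<in>UNIV. (if i then f else g) x)"
      by (rule poly_deg_le_sum) (use * in auto)
    then show ?case by (auto simp: UNIV_bool add.commute)
  next
    case (mult f g)
    then show ?case using poly_deg_le_mult by blast
  qed
next
  assume "\<exists>d. poly_deg_le d p"
  then obtain d c where "\<And>x. p x = (\<Sum>\<alpha>\<in>multi_indices d. c \<alpha> * monomial \<alpha> x)"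
    unfolding poly_deg_le_def by blast
  then have p: "p = (\<lambda>x. \<Sum>\<alpha>\<in>multi_indices d. c \<alpha> * monomial \<alpha> x)" by blast
  show "real_polynomial_function p"
    unfolding p monomial_def
    by (intro real_polynomial_function_sum real_polynomial_function_prod
        real_polynomial_function.intros(2,4) real_polynomial_function_power
        real_polynomial_function.intros(1)[OF bounded_linear_inner_left]
        finite_multi_indices finite_Basis)
qed

section \<open>The sets \<open>\<Xi>\<^sub>1\<close>, \<open>\<Xi>\<^sub>2\<close>, \<open>\<Xi>\<^sub>3\<close>\<close>

definition Xi1 :: "real \<Rightarrow> nat \<Rightarrow> (real^'n \<Rightarrow> real^'n \<Rightarrow> real \<Rightarrow> real) set" where
  "Xi1 \<tau> d = {g. poly_deg_le d (\<lambda>(x1, x2, \<theta>). g x1 x2 \<theta>) \<and>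
     (\<exists>t \<alpha>. poly_deg_le d (\<lambda>(x1, \<theta>). t x1 \<theta>) \<and> \<alpha> > 0 \<and>
        (\<lambda>(x1, x2, \<theta>). g x1 x2 \<theta> - t x1 \<theta> - \<alpha> * (norm x1)\<^sup>2) \<in> sos \<and>
        (\<forall>x1. integral {-\<tau>..0} (\<lambda>\<theta>. t x1 \<theta>) = 0))}"

definition Xi3 :: "real \<Rightarrow> nat \<Rightarrow> (real^'n \<Rightarrow> real^'n \<Rightarrow> real^'n \<Rightarrow> real \<Rightarrow> real) set" where
  "Xi3 \<tau> d = {q. poly_deg_le d (\<lambda>(x1, x2, x3, \<theta>). q x1 x2 x3 \<theta>) \<and>
     (\<exists>t \<alpha>. poly_deg_le d (\<lambda>(x1, x2, \<theta>). t x1 x2 \<theta>) \<and> \<alpha> > 0 \<and>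
        (\<lambda>(x1, x2, x3, \<theta>). q x1 x2 x3 \<theta> - t x1 x2 \<theta> - \<alpha> * (norm x1)\<^sup>2) \<in> sos \<and>
        (\<forall>x1 x2. integral {-\<tau>..0} (\<lambda>\<theta>. t x1 x2 \<theta>) = 0))}"

text \<open>
  Matrices whose size depends on the degree are functions of two indices, used on a finite index
  set only. The entries of \<open>Z\<^sub>m(x)\<close> are the monomials \<open>monomial \<alpha> x\<close> for
  \<open>\<alpha> \<in> multi_indices m\<close>; the rows of \<open>I\<^sub>N \<otimes> (1, \<theta>, \<dots>, \<theta>\<^sup>m)\<^sup>T\<close> are indexed by the pairs
  \<open>(\<alpha>, k)\<close> with \<open>k \<le> m\<close>, its columns by \<open>multi_indices m\<close>.
\<close>

definition psd_on :: "'i set \<Rightarrow> ('i \<Rightarrow> 'i \<Rightarrow> real) \<Rightarrow> bool" where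
  "psd_on I Q \<longleftrightarrow> (\<forall>i\<in>I. \<forall>j\<in>I. Q i j = Q j i) \<and>
     (\<forall>v. (\<Sum>i\<in>I. \<Sum>j\<in>I. v i * Q i j * v j) \<ge> 0)"

definition Zbar :: "real \<Rightarrow> 'i \<times> nat \<Rightarrow> 'i \<Rightarrow> real" where
  "Zbar \<theta> p \<beta> = (if fst p = \<beta> then 1 else 0) * \<theta> ^ snd p"

definition Xi2 :: "nat \<Rightarrow> (real^'n \<Rightarrow> real^'n \<Rightarrow> real \<Rightarrow> real \<Rightarrow> real) set" where
  "Xi2 d = {h. poly_deg_le d (\<lambda>(x1, x2, \<theta>, \<omega>). h x1 x2 \<theta> \<omega>) \<and>
     (\<exists>m Q R. d = 2 * m \<and> psd_on (multi_indices m \<times> {..m}) Q \<and>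
        (\<forall>\<theta> \<omega>. \<forall>\<alpha>\<in>multi_indices m. \<forall>\<beta>\<in>multi_indices m. R \<theta> \<omega> \<alpha> \<beta> =
           (\<Sum>p\<in>multi_indices m \<times> {..m}. \<Sum>q\<in>multi_indices m \<times> {..m}.
              Zbar \<theta> p \<alpha> * Q p q * Zbar \<omega> q \<beta>)) \<and>
        (\<forall>x1 x2 \<theta> \<omega>. h x1 x2 \<theta> \<omega> =
           (\<Sum>\<alpha>\<in>multi_indices m. \<Sum>\<beta>\<in>multi_indices m.
              monomial \<alpha> x1 * R \<theta> \<omega> \<alpha> \<beta> * monomial \<beta> x2)))}"

definition gradient :: "('a::real_inner \<Rightarrow> real) \<Rightarrow> 'a \<Rightarrow> 'a" where
  "gradient F x = (THE D. GDERIV F x :> D)"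

lemma gradient_eqI:
  assumes "GDERIV F x :> D"
  shows "gradient F x = D"
  unfolding gradient_def
proof (rule the_equality)
  fix E assume "GDERIV F x :> E"
  with assms have eq: "(\<lambda>h. h \<bullet> E) = (\<lambda>h. h \<bullet> D)"
    unfolding gderiv_def by (rule has_derivative_unique[rotated])
  show "E = D"
    by (rule vector_eq_ldot[THEN iffD1]) (rule allI, rule fun_cong[OF eq])
qed fact

section \<open>Time-delay systems\<close>

text \<open>
  Elements of \<open>\<C>\<^sub>\<tau>\<close> are functions on the whole real line of which only the restriction to
  \<open>{-\<tau>..0}\<close> matters, and solutions are functions of which only the restriction to \<open>{-\<tau>..}\<close>
  matters. At time 0 the derivative is one-sided.
\<close>

definition delay_sol ::
  "(real^'n \<Rightarrow> real^'n \<Rightarrow> real^'n) \<Rightarrow> real \<Rightarrow> (real \<Rightarrow> real^'n) \<Rightarrow> (real \<Rightarrow> real^'n) \<Rightarrow> bool" where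
  "delay_sol f \<tau> \<phi> x \<longleftrightarrow> continuous_on {-\<tau>..} x \<and> (\<forall>\<theta>\<in>{-\<tau>..0}. x \<theta> = \<phi> \<theta>) \<and>
     (\<forall>t\<ge>0. (x has_vector_derivative f (x t) (x (t - \<tau>))) (at t within {0..}))"

definition delay_unique_sol :: "(real^'n \<Rightarrow> real^'n \<Rightarrow> real^'n) \<Rightarrow> real \<Rightarrow> bool" where
  "delay_unique_sol f \<tau> \<longleftrightarrow> (\<forall>\<phi>. continuous_on {-\<tau>..0} \<phi> \<longrightarrow>
     (\<exists>x. delay_sol f \<tau> \<phi> x \<and> (\<forall>y. delay_sol f \<tau> \<phi> y \<longrightarrow> (\<forall>t\<ge>-\<tau>. y t = x t))))"

text \<open>
  The first conjunct makes every solution bounded, so the supremum over the unbounded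
  interval in the second one is a genuine least upper bound.
\<close>

definition delay_gas :: "(real^'n \<Rightarrow> real^'n \<Rightarrow> real^'n) \<Rightarrow> real \<Rightarrow> bool" where
  "delay_gas f \<tau> \<longleftrightarrow>
     (\<forall>\<phi> x. continuous_on {-\<tau>..0} \<phi> \<and> delay_sol f \<tau> \<phi> x \<longrightarrow> bounded (x ` {-\<tau>..})) \<and>
     (\<forall>\<epsilon>>0. \<exists>\<delta>>0. \<forall>\<phi> x. continuous_on {-\<tau>..0} \<phi> \<and> delay_sol f \<tau> \<phi> x \<and>
        (SUP \<theta>\<in>{-\<tau>..0}. norm (\<phi> \<theta>)) < \<delta> \<longrightarrow> (SUP t\<in>{-\<tau>..}. norm (x t)) < \<epsilon>) \<and>
     (\<forall>\<phi> x. continuous_on {-\<tau>..0} \<phi> \<and> delay_sol f \<tau> \<phi> x \<longrightarrow> (x \<longlongrightarrow> 0) at_top)"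

end

theory Submission
  imports Defs
begin

text \<open>
  The argument is the Lyapunov--Krasovskii method. For a history \<open>y\<close> on \<open>{-\<tau>..0}\<close> put
  \<open>V(y) = \<integral> g(y(0), y(\<theta>), \<theta>) d\<theta> + \<integral>\<integral> h(y(\<theta>), y(\<omega>), \<theta>, \<omega>) d\<omega> d\<theta>\<close>, all integrals over \<open>{-\<tau>..0}\<close>.
  The function \<open>t\<close> in the definition of \<open>\<Xi>\<^sub>1\<close> disappears after integration, and the double
  integral of a kernel in \<open>\<Xi>\<^sub>2\<close> is a positive semidefinite quadratic form, so \<open>V(y)\<close> is at least a
  positive multiple of \<open>|y(0)|\<^sup>2\<close>. Along a solution, with \<open>x\<^sub>t\<close> the history at time \<open>t\<close>,
  \<open>\<tau> (d/dt) V(x\<^sub>t) = \<integral> g'(x(t), x(t - \<tau>), x(t + \<theta>), \<theta>) d\<theta> - \<tau> \<integral>\<integral> h'(x(t + \<theta>), x(t + \<omega>), \<theta>, \<omega>) d\<omega> d\<theta>\<close>,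
  which by the same two facts is at most a negative multiple of \<open>|x(t)|\<^sup>2\<close>.

  A history is only continuous, so \<open>V(x\<^sub>t)\<close> cannot be differentiated under the integral sign at
  once. Since \<open>g\<close> and \<open>h\<close> are polynomials, however, they are finite sums of products of functions
  of one argument (\<open>poly_deg_le_separable\<close>, \<open>Xi2_quadratic_form\<close>). Hence \<open>V\<close> is a polynomial
  expression in functions of \<open>y(0)\<close> and in the moments \<open>\<integral> b(y(\<theta>)) \<theta>\<^sup>k d\<theta>\<close>, no genuine double
  integral remains, and everything reduces to the derivative of a moment along a shifted history
  (\<open>moment_has_derivative\<close>), where an integration by parts moves the shift onto a
  differentiable function.

  From the two inequalities to stability (\<open>Lyapunov_Krasovskii\<close>) one point needs
  care: a constant may be added to \<open>g\<close>, so \<open>V(0)\<close> may be positive, and the lower bound on \<open>V\<close>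
  alone gives boundedness but not stability. What helps is that every solution tends to \<open>0\<close>: then
  \<open>V(x\<^sub>t)\<close> decreases to \<open>V(0)\<close>, so \<open>V(x\<^sub>t) - V(0)\<close> is nonnegative, and it is small for small initial
  data. As the velocity is bounded, an excursion of size \<open>\<epsilon>\<close> lasts for a time bounded below
  and thereby costs a fixed amount of \<open>V\<close> (\<open>energy_drop\<close>), more than is available. The same
  estimate gives the convergence to \<open>0\<close>, because a bounded energy cannot drop by
  a fixed amount infinitely often.
\<close>

section \<open>Polynomials as sums of products\<close>

lemma real_polynomial_monomial: "real_polynomial_function (monomial \<alpha>)"
  using poly_deg_le_monomial[OF order_refl, of \<alpha> 1] real_polynomial_function_iff_deg by auto

lemma real_polynomial_function_continuous_on: "real_polynomial_function p \<Longrightarrow> continuous_on S p"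
  using continuous_on_polymonial_function real_polynomial_function_eq by blast

lemma monomial_continuous: "continuous_on S (monomial \<alpha>)"
  by (intro real_polynomial_function_continuous_on real_polynomial_monomial)

lemma poly_deg_le_continuous: "poly_deg_le d p \<Longrightarrow> continuous_on S p"
  using real_polynomial_function_iff_deg real_polynomial_function_continuous_on by blast

lemma monomial_real: "monomial \<alpha> (\<theta>::real) = \<theta> ^ \<alpha> 1"
  by (simp add: monomial_def)

lemma monomial_Pair:
  "monomial \<alpha> (x, y) = monomial (\<lambda>b. \<alpha> (b, 0)) x * monomial (\<lambda>b. \<alpha> (0, b)) y"
proof -
  have "monomial \<alpha> (x, y) =
      (\<Prod>b\<in>(\<lambda>u. (u, 0)) ` Basis. ((x, y) \<bullet> b) ^ \<alpha> b) *
      (\<Prod>b\<in>(\<lambda>u. (0, u)) ` Basis. ((x, y) \<bullet> b) ^ \<alpha> b)"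
    unfolding monomial_def Basis_prod_def
    by (rule prod.union_disjoint) auto
  also have "\<dots> = monomial (\<lambda>b. \<alpha> (b, 0)) x * monomial (\<lambda>b. \<alpha> (0, b)) y"
    by (simp add: monomial_def prod.reindex inj_on_def)
  finally show ?thesis .
qed

text \<open>
  Separation of variables: it turns integrals over a history into moments. The coefficients are
  absorbed into the factors \<open>A i\<close>.
\<close>

lemma poly_deg_le_separable:
  fixes g :: "'a::euclidean_space \<Rightarrow> 'b::euclidean_space \<Rightarrow> real \<Rightarrow> real"
  assumes "poly_deg_le d (\<lambda>(x1, x2, \<theta>). g x1 x2 \<theta>)"
  obtains I :: "('a \<times> 'b \<times> real \<Rightarrow> nat) set" and A B k where "finite I"
    and "\<And>i. real_polynomial_function (A i)" and "\<And>i. real_polynomial_function (B i)"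
    and "\<And>x1 x2 \<theta>. g x1 x2 \<theta> = (\<Sum>i\<in>I. A i x1 * (B i x2 * \<theta> ^ k i))"
proof -
  obtain c where c: "\<And>x1 x2 \<theta>. g x1 x2 \<theta> = (\<Sum>\<alpha>\<in>multi_indices d. c \<alpha> * monomial \<alpha> (x1, x2, \<theta>))"
  proof -
    obtain c where "\<forall>z. (case z of (x1, x2, \<theta>) \<Rightarrow> g x1 x2 \<theta>) =
        (\<Sum>\<alpha>\<in>multi_indices d. c \<alpha> * monomial \<alpha> z)"
      using assms unfolding poly_deg_le_def by (rule exE)
    then have "g x1 x2 \<theta> = (\<Sum>\<alpha>\<in>multi_indices d. c \<alpha> * monomial \<alpha> (x1, x2, \<theta>))" for x1 x2 \<theta>
      by (drule_tac spec[of _ "(x1, x2, \<theta>)"]) simp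
    then show ?thesis by (rule that)
  qed
  show ?thesis
  proof (rule that)
    show "finite (multi_indices d :: ('a \<times> 'b \<times> real \<Rightarrow> nat) set)"
      by (rule finite_multi_indices)
    show "real_polynomial_function (\<lambda>x. c \<alpha> * monomial (\<lambda>b. \<alpha> (b, 0)) x)" for \<alpha> :: "'a \<times> 'b \<times> real \<Rightarrow> nat"
      by (intro real_polynomial_function.intros real_polynomial_monomial)
    show "real_polynomial_function (monomial (\<lambda>b. \<alpha> (0, b, 0)))" for \<alpha> :: "'a \<times> 'b \<times> real \<Rightarrow> nat"
      by (rule real_polynomial_monomial)
    show "g x1 x2 \<theta> = (\<Sum>\<alpha>\<in>multi_indices d. c \<alpha> * monomial (\<lambda>b. \<alpha> (b, 0)) x1 *
        (monomial (\<lambda>b. \<alpha> (0, b, 0)) x2 * \<theta> ^ \<alpha> (0, 0, 1)))" for x1 x2 \<theta>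
      by (simp add: c monomial_Pair monomial_real zero_prod_def mult.assoc)
  qed
qed

text \<open>
  Contracting \<open>Zbar\<close> with the vector of monomials leaves a quadratic form in the functions
  \<open>monomial \<alpha> x * \<theta> ^ k\<close>. In this form the matrix \<open>Q\<close> no longer depends on \<open>\<theta>\<close> and \<open>\<omega>\<close>, so that it
  can be pulled out of a double integral.
\<close>

lemma Xi2_quadratic_form:
  fixes h :: "real^'n \<Rightarrow> real^'n \<Rightarrow> real \<Rightarrow> real \<Rightarrow> real"
  assumes "h \<in> Xi2 d"
  obtains P :: "((real^'n \<Rightarrow> nat) \<times> nat) set" and Q
  where "finite P" "psd_on P Q"
    "\<And>x1 x2 \<theta> \<omega>. h x1 x2 \<theta> \<omega> = (\<Sum>p\<in>P. \<Sum>q\<in>P.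
      (monomial (fst p) x1 * \<theta> ^ snd p) * (Q p q * (monomial (fst q) x2 * \<omega> ^ snd q)))"
proof -
  obtain m Q R where psd: "psd_on (multi_indices m \<times> {..m}) Q"
    and R: "\<And>\<theta> \<omega> \<alpha> \<beta>. \<alpha> \<in> multi_indices m \<Longrightarrow> \<beta> \<in> multi_indices m \<Longrightarrow> R \<theta> \<omega> \<alpha> \<beta> =
           (\<Sum>p\<in>multi_indices m \<times> {..m}. \<Sum>q\<in>multi_indices m \<times> {..m}.
              Zbar \<theta> p \<alpha> * Q p q * Zbar \<omega> q \<beta>)"
    and h: "\<And>x1 x2 \<theta> \<omega>. h x1 x2 \<theta> \<omega> =
           (\<Sum>\<alpha>\<in>multi_indices m. \<Sum>\<beta>\<in>multi_indices m.
              monomial \<alpha> x1 * R \<theta> \<omega> \<alpha> \<beta> * monomial \<beta> x2)"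
    using assms unfolding Xi2_def by blast
  let ?M = "multi_indices m :: (real^'n \<Rightarrow> nat) set" 
  let ?P = "?M \<times> {..m}"
  have fin: "finite ?M" by (rule finite_multi_indices)
  have Z: "(\<Sum>\<alpha>\<in>?M. monomial \<alpha> x * Zbar \<theta> p \<alpha>) = monomial (fst p) x * \<theta> ^ snd p"
    if "p \<in> ?P" for x \<theta> p
  proof -
    have "(\<Sum>\<alpha>\<in>?M. monomial \<alpha> x * Zbar \<theta> p \<alpha>) =
        (\<Sum>\<alpha>\<in>?M. if fst p = \<alpha> then monomial (fst p) x * \<theta> ^ snd p else 0)"
      by (rule sum.cong) (auto simp: Zbar_def)
    also have "\<dots> = monomial (fst p) x * \<theta> ^ snd p"
      using that fin by (subst sum.delta') auto
    finally show ?thesis .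
  qed
  have "h x1 x2 \<theta> \<omega> = (\<Sum>p\<in>?P. \<Sum>q\<in>?P.
      (monomial (fst p) x1 * \<theta> ^ snd p) * (Q p q * (monomial (fst q) x2 * \<omega> ^ snd q)))" for x1 x2 \<theta> \<omega>
  proof -
    have "h x1 x2 \<theta> \<omega> = (\<Sum>\<alpha>\<in>?M. \<Sum>\<beta>\<in>?M. \<Sum>p\<in>?P. \<Sum>q\<in>?P.
        (monomial \<alpha> x1 * Zbar \<theta> p \<alpha>) * (Q p q * (monomial \<beta> x2 * Zbar \<omega> q \<beta>)))"
      unfolding h
    proof (intro sum.cong refl)
      fix \<alpha> \<beta> assume "\<alpha> \<in> ?M" "\<beta> \<in> ?M"
      show "monomial \<alpha> x1 * R \<theta> \<omega> \<alpha> \<beta> * monomial \<beta> x2 = (\<Sum>p\<in>?P. \<Sum>q\<in>?P.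
          (monomial \<alpha> x1 * Zbar \<theta> p \<alpha>) * (Q p q * (monomial \<beta> x2 * Zbar \<omega> q \<beta>)))"
        unfolding R[OF \<open>\<alpha> \<in> ?M\<close> \<open>\<beta> \<in> ?M\<close>] sum_distrib_left sum_distrib_right
        by (intro sum.cong refl) (simp only: mult_ac)
    qed
    also have "\<dots> = (\<Sum>\<alpha>\<in>?M. \<Sum>p\<in>?P. \<Sum>\<beta>\<in>?M. \<Sum>q\<in>?P.
        (monomial \<alpha> x1 * Zbar \<theta> p \<alpha>) * (Q p q * (monomial \<beta> x2 * Zbar \<omega> q \<beta>)))"
      by (rule sum.cong[OF refl]) (rule sum.swap)
    also have "\<dots> = (\<Sum>p\<in>?P. \<Sum>\<alpha>\<in>?M. \<Sum>q\<in>?P. \<Sum>\<beta>\<in>?M.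
        (monomial \<alpha> x1 * Zbar \<theta> p \<alpha>) * (Q p q * (monomial \<beta> x2 * Zbar \<omega> q \<beta>)))"
      by (subst sum.swap) (rule sum.cong[OF refl], rule sum.cong[OF refl], rule sum.swap)
    also have "\<dots> = (\<Sum>p\<in>?P. \<Sum>q\<in>?P. \<Sum>\<alpha>\<in>?M. \<Sum>\<beta>\<in>?M.
        (monomial \<alpha> x1 * Zbar \<theta> p \<alpha>) * (Q p q * (monomial \<beta> x2 * Zbar \<omega> q \<beta>)))"
      by (rule sum.cong[OF refl]) (rule sum.swap)
    also have "\<dots> = (\<Sum>p\<in>?P. \<Sum>q\<in>?P. (\<Sum>\<alpha>\<in>?M. monomial \<alpha> x1 * Zbar \<theta> p \<alpha>) *
        (Q p q * (\<Sum>\<beta>\<in>?M. monomial \<beta> x2 * Zbar \<omega> q \<beta>)))"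
      by (intro sum.cong refl) (subst sum_distrib_left, rule sum_product[symmetric])
    also have "\<dots> = (\<Sum>p\<in>?P. \<Sum>q\<in>?P.
        (monomial (fst p) x1 * \<theta> ^ snd p) * (Q p q * (monomial (fst q) x2 * \<omega> ^ snd q)))"
      by (intro sum.cong refl) (simp only: Z)
    finally show ?thesis .
  qed
  with that[of ?P Q] fin psd show ?thesis by blast
qed

section \<open>Moments of a history\<close>

definition moment :: "real \<Rightarrow> ('a::topological_space \<Rightarrow> real) \<Rightarrow> nat \<Rightarrow> (real \<Rightarrow> 'a) \<Rightarrow> real" where
  "moment \<tau> b k y = integral {-\<tau>..0} (\<lambda>\<theta>. b (y \<theta>) * \<theta> ^ k)"

lemma moment_integrand_continuous:
  fixes b :: "'a::topological_space \<Rightarrow> real"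
  assumes "continuous_on UNIV b" "continuous_on {-\<tau>..0} y"
  shows "continuous_on {-\<tau>..0} (\<lambda>\<theta>. b (y \<theta>) * \<theta> ^ k)"
  by (intro continuous_on_mult continuous_on_power continuous_on_id
      continuous_on_compose2[OF assms]) auto

lemma moment_has_integral:
  assumes "continuous_on UNIV b" "continuous_on {-\<tau>..0} y"
  shows "((\<lambda>\<theta>. b (y \<theta>) * \<theta> ^ k) has_integral moment \<tau> b k y) {-\<tau>..0}"
  unfolding moment_def
  by (intro integrable_integral integrable_continuous_real moment_integrand_continuous assms)

lemma has_integral_weighted_sum:
  fixes c :: "'i \<Rightarrow> real"
  assumes "finite I" "\<And>i. i \<in> I \<Longrightarrow> (b i has_integral B i) S"
  shows "((\<lambda>\<omega>. \<Sum>i\<in>I. c i * b i \<omega>) has_integral (\<Sum>i\<in>I. c i * B i)) S"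
  using assms by (intro has_integral_sum has_integral_mult_right) auto

lemma continuous_on_history:
  fixes x :: "real \<Rightarrow> 'a::topological_space"
  assumes "continuous_on {-\<tau>..} x" "t \<ge> 0"
  shows "continuous_on {-\<tau>..0} (\<lambda>\<theta>. x (t + \<theta>))"
  using assms(2) by (intro continuous_on_compose2[OF assms(1)]) (auto intro!: continuous_intros)

lemma moment_scaled_has_integral:
  fixes b :: "'a::topological_space \<Rightarrow> real"
  assumes "continuous_on UNIV b" "continuous_on {-\<tau>..0} y"
  shows "((\<lambda>\<theta>. b (y \<theta>) * (real k * \<theta> ^ (k - 1))) has_integral real k * moment \<tau> b (k - 1) y) {-\<tau>..0}"
  using has_integral_mult_right[OF moment_has_integral[OF assms, of "k - 1"], of "real k"]
  by (simp add: mult_ac)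

text \<open>
  The function \<open>x\<close> is merely continuous, so differentiation under the integral sign does not
  apply to \<open>b (x (t + \<theta>)) * \<theta> ^ k\<close> itself. With an antiderivative \<open>B\<close> of \<open>b \<circ> x\<close>, integration by
  parts in \<open>\<theta>\<close> replaces \<open>b (x (t + \<theta>))\<close> by \<open>B (t + \<theta>)\<close>, which is continuously differentiable in
  \<open>t\<close>; then the Leibniz rule applies.
\<close>

lemma moment_has_derivative:
  fixes x :: "real \<Rightarrow> 'a::topological_space"
  assumes "\<tau> \<ge> 0" "continuous_on UNIV b" "continuous_on {-\<tau>..} x" "t \<ge> 0"
  shows "((\<lambda>t. moment \<tau> b k (\<lambda>\<theta>. x (t + \<theta>))) has_real_derivative
      (b (x t) * 0 ^ k - b (x (t - \<tau>)) * (-\<tau>) ^ k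
        - real k * moment \<tau> b (k - 1) (\<lambda>\<theta>. x (t + \<theta>)))) (at t within {0..})"
proof -
  define \<beta> where "\<beta> = (\<lambda>s. b (x s))"
  define B where "B = (\<lambda>t. integral {-\<tau>..t} \<beta>)"
  define w :: "real \<Rightarrow> real" where "w = (\<lambda>\<theta>. \<theta> ^ k)"
  define w' :: "real \<Rightarrow> real" where "w' = (\<lambda>\<theta>. of_nat k * \<theta> ^ (k - 1))"
  have contw': "continuous_on A w'" for A unfolding w'_def by (intro continuous_intros)
  have contw: "continuous_on A w" for A unfolding w_def by (intro continuous_intros)
  have w: "(w has_real_derivative w' \<theta>) (at \<theta>)" for \<theta>
    unfolding w_def w'_def by (auto intro!: derivative_eq_intros)
  have cont: "continuous_on {-\<tau>..} \<beta>"
    unfolding \<beta>_def by (rule continuous_on_compose2[OF assms(2,3)]) auto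
  have B: "(B has_real_derivative \<beta> s) (at s within {-\<tau>..})" if "s \<ge> -\<tau>" for s
  proof -
    have "(B has_real_derivative \<beta> s) (at s within {-\<tau>..s+1})"
      unfolding B_def using that
      by (intro integral_has_real_derivative continuous_on_subset[OF cont]) auto
    moreover have "at s within {-\<tau>..} = at s within {-\<tau>..s+1}"
      by (rule at_within_nhd[of s "{..<s+1}"]) auto
    ultimately show ?thesis by simp
  qed
  have contB: "continuous_on {-\<tau>..} B"
    using B by (intro DERIV_continuous_on) auto
  have shift: "((\<lambda>u. B (u + \<theta>)) has_real_derivative \<beta> (s + \<theta>)) (at s within S)"
    if "s \<in> S" "\<And>u. u \<in> S \<Longrightarrow> u + \<theta> \<ge> -\<tau>" for s \<theta> S
  proof -
    have "(B \<circ> (\<lambda>u. u + \<theta>) has_real_derivative \<beta> (s + \<theta>) * 1) (at s within S)"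
      using that by (intro DERIV_image_chain DERIV_subset[OF B]) (auto intro!: derivative_eq_intros)
    then show ?thesis by (simp add: o_def)
  qed
  have parts: "moment \<tau> b k (\<lambda>\<theta>. x (s + \<theta>)) =
      B s * w 0 - B (s - \<tau>) * w (-\<tau>) - integral {-\<tau>..0} (\<lambda>\<theta>. B (s + \<theta>) * w' \<theta>)"
    if "s \<ge> 0" for s
  proof -
    have c: "continuous_on {-\<tau>..0} (\<lambda>\<theta>. B (s + \<theta>))"
      using that by (intro continuous_on_compose2[OF contB]) (auto intro!: continuous_intros)
    have "((\<lambda>\<theta>. \<beta> (s + \<theta>) * w \<theta>) has_integral
        (B s * w 0 - B (s - \<tau>) * w (-\<tau>) - integral {-\<tau>..0} (\<lambda>\<theta>. B (s + \<theta>) * w' \<theta>))) {-\<tau>..0}"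
    proof (rule integration_by_parts_interior[OF bounded_bilinear_mult])
      show "-\<tau> \<le> 0" using assms by simp
      show "continuous_on {-\<tau>..0} (\<lambda>\<theta>. B (s + \<theta>))" by (rule c)
      show "continuous_on {-\<tau>..0} w" by (rule contw)
      show "(w has_vector_derivative w' \<theta>) (at \<theta>)" for \<theta>
        using w by (simp add: has_real_derivative_iff_has_vector_derivative)
      show "((\<lambda>\<theta>. B (s + \<theta>)) has_vector_derivative \<beta> (s + \<theta>)) (at \<theta>)"
        if "\<theta> \<in> {-\<tau><..<0}" for \<theta>
      proof -
        have "((\<lambda>\<theta>. B (\<theta> + s)) has_real_derivative \<beta> (\<theta> + s)) (at \<theta> within {-\<tau><..<0})"
          using that \<open>s \<ge> 0\<close> by (intro shift) auto
        moreover have "at \<theta> within {-\<tau><..<0} = at \<theta>"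
          using that by (intro at_within_open) auto
        ultimately show ?thesis
          by (simp add: has_real_derivative_iff_has_vector_derivative add.commute)
      qed
      have "((\<lambda>\<theta>. B (s + \<theta>) * w' \<theta>) has_integral integral {-\<tau>..0} (\<lambda>\<theta>. B (s + \<theta>) * w' \<theta>)) {-\<tau>..0}"
        by (intro integrable_integral integrable_continuous_real continuous_intros c contw')
      then show "((\<lambda>\<theta>. B (s + \<theta>) * w' \<theta>) has_integral
          B (s + 0) * w 0 - B (s + -\<tau>) * w (-\<tau>) - (B s * w 0 - B (s - \<tau>) * w (-\<tau>) -
            integral {-\<tau>..0} (\<lambda>\<theta>. B (s + \<theta>) * w' \<theta>))) {-\<tau>..0}"
        by simp
    qed
    then show ?thesis
      unfolding moment_def \<beta>_def w_def by (rule integral_unique)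
  qed
  have leib: "((\<lambda>s. integral {-\<tau>..0} (\<lambda>\<theta>. B (s + \<theta>) * w' \<theta>)) has_real_derivative
      integral {-\<tau>..0} (\<lambda>\<theta>. \<beta> (t + \<theta>) * w' \<theta>)) (at t within {0..})"
  proof -
    have "((\<lambda>s. integral (cbox (-\<tau>) 0) (\<lambda>\<theta>. B (s + \<theta>) * w' \<theta>)) has_real_derivative
      integral (cbox (-\<tau>) 0) (\<lambda>\<theta>. \<beta> (t + \<theta>) * w' \<theta>)) (at t within {0..})"
    proof (rule leibniz_rule_field_derivative)
      show "((\<lambda>s. B (s + \<theta>) * w' \<theta>) has_real_derivative \<beta> (s + \<theta>) * w' \<theta>) (at s within {0..})"
        if "s \<in> {0..}" "\<theta> \<in> cbox (-\<tau>) 0" for s \<theta>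
        using that by (intro DERIV_cmult_right shift) auto
      show "(\<lambda>\<theta>. B (s + \<theta>) * w' \<theta>) integrable_on cbox (-\<tau>) 0" if "s \<in> {0..}" for s
        using that by (intro integrable_continuous continuous_on_mult contw'
            continuous_on_compose2[OF contB]) (auto intro!: continuous_intros)
      show "continuous_on ({0..} \<times> cbox (-\<tau>) 0) (\<lambda>(s, \<theta>). \<beta> (s + \<theta>) * w' \<theta>)"
        unfolding split_beta
        by (intro continuous_on_mult continuous_on_compose2[OF cont]
            continuous_on_compose2[OF contw'[of UNIV]]) (auto intro!: continuous_intros)
    qed (use assms in auto)
    then show ?thesis by simp
  qed
  have B1: "(B has_real_derivative \<beta> t) (at t within {0..})"
    using shift[of t "{0..}" 0] assms by simp
  have B2: "((\<lambda>s. B (s - \<tau>)) has_real_derivative \<beta> (t - \<tau>)) (at t within {0..})"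
    using shift[of t "{0..}" "-\<tau>"] assms by simp
  have "((\<lambda>s. B s * w 0 - B (s - \<tau>) * w (-\<tau>) - integral {-\<tau>..0} (\<lambda>\<theta>. B (s + \<theta>) * w' \<theta>))
      has_real_derivative (\<beta> t * w 0 - \<beta> (t - \<tau>) * w (-\<tau>) - integral {-\<tau>..0} (\<lambda>\<theta>. \<beta> (t + \<theta>) * w' \<theta>)))
      (at t within {0..})"
    by (intro DERIV_diff DERIV_cmult_right leib B1 B2)
  then have "((\<lambda>t. moment \<tau> b k (\<lambda>\<theta>. x (t + \<theta>))) has_real_derivative
      (\<beta> t * w 0 - \<beta> (t - \<tau>) * w (-\<tau>) - integral {-\<tau>..0} (\<lambda>\<theta>. \<beta> (t + \<theta>) * w' \<theta>)))
      (at t within {0..})"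
    by (rule has_field_derivative_transform_within[where d = 1]) (use assms parts in auto)
  moreover have "integral {-\<tau>..0} (\<lambda>\<theta>. \<beta> (t + \<theta>) * w' \<theta>) =
      real k * moment \<tau> b (k - 1) (\<lambda>\<theta>. x (t + \<theta>))"
    unfolding \<beta>_def w'_def
    by (intro integral_unique moment_scaled_has_integral continuous_on_history assms)
  ultimately show ?thesis by (simp add: \<beta>_def w_def)
qed

section \<open>Derivatives of the single and the double integral\<close>

lemma gradient_inner:
  fixes F :: "'a::euclidean_space \<Rightarrow> real"
  assumes "(F has_derivative F') (at x)"
  shows "gradient F x \<bullet> v = F' v"
proof -
  have lin: "linear F'"
    using assms by (rule has_derivative_linear)
  have D: "u \<bullet> adjoint F' 1 = F' u" for u
    using adjoint_works[OF lin, of u 1] by simp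
  have "GDERIV F x :> adjoint F' 1"
    using assms by (simp add: gderiv_def D)
  then show ?thesis
    using D[of v] gradient_eqI by (metis inner_commute)
qed

lemma has_real_derivative_along:
  fixes x :: "real \<Rightarrow> 'a::real_normed_vector"
  assumes "(x has_vector_derivative v) (at t within S)" "(F has_derivative F') (at (x t))"
  shows "((\<lambda>s. F (x s)) has_real_derivative F' v) (at t within S)"
proof -
  have "linear F'" using assms(2) by (rule has_derivative_linear)
  then have F': "F' (r *\<^sub>R v) = F' v * r" for r by (simp add: linear_scale)
  have "((\<lambda>s. F (x s)) has_derivative (\<lambda>r. F' (r *\<^sub>R v))) (at t within S)"
    using assms unfolding has_vector_derivative_def by (rule has_derivative_compose)
  then show ?thesis
    by (simp add: has_field_derivative_def F')
qed

lemma single_integral_eq: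
  fixes y :: "real \<Rightarrow> 'a::euclidean_space" and k :: "'i \<Rightarrow> nat"
  assumes "finite I" and "\<And>i. real_polynomial_function (B i)"
    and "\<And>x1 x2 \<theta>. g x1 x2 \<theta> = (\<Sum>i\<in>I. A i x1 * (B i x2 * \<theta> ^ k i))"
    and "continuous_on {-\<tau>..0} y"
  shows "integral {-\<tau>..0} (\<lambda>\<theta>. g z (y \<theta>) \<theta>) = (\<Sum>i\<in>I. A i z * moment \<tau> (B i) (k i) y)"
  unfolding assms(3)
  by (intro integral_unique has_integral_weighted_sum moment_has_integral real_polynomial_function_continuous_on assms)

text \<open>
  The first argument contributes the gradient by the product rule; the second one moves with the
  window of integration and contributes the two boundary terms and the derivative in \<open>\<theta>\<close>, as for
  every moment. The value \<open>J\<close> is obtained together with the integrability of the integrand.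
\<close>

lemma single_integral_has_derivative:
  fixes g :: "'a::euclidean_space \<Rightarrow> 'a \<Rightarrow> real \<Rightarrow> real"
  assumes "\<tau> \<ge> 0" and g: "poly_deg_le d (\<lambda>(x1, x2, \<theta>). g x1 x2 \<theta>)"
    and x: "continuous_on {-\<tau>..} x" and t: "t \<ge> 0"
    and v: "(x has_vector_derivative v) (at t within {0..})"
  obtains J where
    "((\<lambda>\<theta>. gradient (\<lambda>y. g y (x (t + \<theta>)) \<theta>) (x t) \<bullet> v - deriv (\<lambda>s. g (x t) (x (t + \<theta>)) s) \<theta>)
      has_integral J) {-\<tau>..0}"
    "((\<lambda>t. integral {-\<tau>..0} (\<lambda>\<theta>. g (x t) (x (t + \<theta>)) \<theta>)) has_real_derivative
      (g (x t) (x t) 0 - g (x t) (x (t - \<tau>)) (-\<tau>) + J)) (at t within {0..})"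
proof -
  obtain I :: "('a \<times> 'a \<times> real \<Rightarrow> nat) set" and A B k where fin: "finite I"
    and A: "\<And>i. real_polynomial_function (A i)" and B: "\<And>i. real_polynomial_function (B i)"
    and geq: "\<And>x1 x2 \<theta>. g x1 x2 \<theta> = (\<Sum>i\<in>I. A i x1 * (B i x2 * \<theta> ^ k i))"
    by (rule poly_deg_le_separable[OF g]) (rule that)
  have contB: "continuous_on UNIV (B i)" for i using B by (rule real_polynomial_function_continuous_on)
  define DA where "DA i z = frechet_derivative (A i) (at z)" for i z
  have DA: "(A i has_derivative DA i z) (at z)" for i z
    unfolding DA_def using A differentiable_at_real_polynomial_function frechet_derivative_works by blast
  let ?y = "\<lambda>t \<theta>. x (t + \<theta>)"
  have y: "continuous_on {-\<tau>..0} (?y s)" if "s \<ge> 0" for s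
    using x that by (rule continuous_on_history)
  have val: "integral {-\<tau>..0} (\<lambda>\<theta>. g (x s) (x (s + \<theta>)) \<theta>) =
      (\<Sum>i\<in>I. A i (x s) * moment \<tau> (B i) (k i) (?y s))" if "s \<ge> 0" for s
    by (rule single_integral_eq[OF fin B geq y[OF that]])
  let ?J = "(\<Sum>i\<in>I. DA i (x t) v * moment \<tau> (B i) (k i) (?y t)) -
    (\<Sum>i\<in>I. A i (x t) * (real (k i) * moment \<tau> (B i) (k i - 1) (?y t)))"
  have grad: "gradient (\<lambda>y. g y x2 \<theta>) z \<bullet> v = (\<Sum>i\<in>I. DA i z v * (B i x2 * \<theta> ^ k i))" for x2 \<theta> z
    unfolding geq by (rule gradient_inner, rule has_derivative_sum, rule has_derivative_mult_left, rule DA)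
  have der: "deriv (\<lambda>s. g z x2 s) \<theta> = (\<Sum>i\<in>I. A i z * (B i x2 * (real (k i) * \<theta> ^ (k i - 1))))" for x2 \<theta> z
    unfolding geq by (rule DERIV_imp_deriv) (auto intro!: derivative_eq_intros sum.cong)
  have "((\<lambda>\<theta>. gradient (\<lambda>y. g y (x (t + \<theta>)) \<theta>) (x t) \<bullet> v - deriv (\<lambda>s. g (x t) (x (t + \<theta>)) s) \<theta>)
      has_integral ?J) {-\<tau>..0}"
    unfolding grad der
    by (intro has_integral_diff has_integral_weighted_sum fin moment_has_integral
        moment_scaled_has_integral contB y t)
  moreover have "((\<lambda>t. integral {-\<tau>..0} (\<lambda>\<theta>. g (x t) (x (t + \<theta>)) \<theta>)) has_real_derivative
      (g (x t) (x t) 0 - g (x t) (x (t - \<tau>)) (-\<tau>) + ?J)) (at t within {0..})"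
  proof -
    have "((\<lambda>s. \<Sum>i\<in>I. A i (x s) * moment \<tau> (B i) (k i) (?y s)) has_real_derivative
      (\<Sum>i\<in>I. A i (x t) * (B i (x t) * 0 ^ k i - B i (x (t - \<tau>)) * (-\<tau>) ^ k i
         - real (k i) * moment \<tau> (B i) (k i - 1) (?y t))
         + DA i (x t) v * moment \<tau> (B i) (k i) (?y t))) (at t within {0..})"
      by (intro DERIV_sum DERIV_mult' has_real_derivative_along[OF v] DA
          moment_has_derivative assms contB)
    then have "((\<lambda>s. \<Sum>i\<in>I. A i (x s) * moment \<tau> (B i) (k i) (?y s)) has_real_derivative
      (g (x t) (x t) 0 - g (x t) (x (t - \<tau>)) (-\<tau>) + ?J)) (at t within {0..})"
      by (rule back_subst[where P = "\<lambda>D. (_ has_real_derivative D) _"])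
        (simp add: geq sum.distrib sum_subtractf algebra_simps)
    then show ?thesis
      by (rule has_field_derivative_transform_within[where d = 1]) (use t val in auto)
  qed
  ultimately show ?thesis by (rule that)
qed

lemma double_integral_eq:
  fixes h :: "real^'n \<Rightarrow> real^'n \<Rightarrow> real \<Rightarrow> real \<Rightarrow> real"
  assumes "finite P"
    and h: "\<And>x1 x2 \<theta> \<omega>. h x1 x2 \<theta> \<omega> = (\<Sum>p\<in>P. \<Sum>q\<in>P.
      (monomial (fst p) x1 * \<theta> ^ snd p) * (Q p q * (monomial (fst q) x2 * \<omega> ^ snd q)))"
    and y: "continuous_on {-\<tau>..0} y"
  shows "integral {-\<tau>..0} (\<lambda>\<theta>. integral {-\<tau>..0} (\<lambda>\<omega>. h (y \<theta>) (y \<omega>) \<theta> \<omega>)) =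
    (\<Sum>p\<in>P. \<Sum>q\<in>P. moment \<tau> (monomial (fst p)) (snd p) y *
       (Q p q * moment \<tau> (monomial (fst q)) (snd q) y))"
proof -
  have "integral {-\<tau>..0} (\<lambda>\<omega>. h (y \<theta>) (y \<omega>) \<theta> \<omega>) = (\<Sum>p\<in>P. \<Sum>q\<in>P.
      (monomial (fst p) (y \<theta>) * \<theta> ^ snd p) * (Q p q * moment \<tau> (monomial (fst q)) (snd q) y))" for \<theta>
    unfolding h
    by (intro integral_unique has_integral_sum has_integral_mult_right moment_has_integral
        monomial_continuous y assms(1))
  then show ?thesis
    by (simp only:) (intro integral_unique has_integral_sum has_integral_mult_left
        moment_has_integral monomial_continuous y assms(1))
qed

text \<open>
  The double integral is the quadratic form of \<open>Q\<close> at the vector of moments of \<open>y\<close>.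
\<close>

lemma Xi2_double_integral_nonneg:
  assumes "h \<in> Xi2 d" "continuous_on {-\<tau>..0} y"
  shows "integral {-\<tau>..0} (\<lambda>\<theta>. integral {-\<tau>..0} (\<lambda>\<omega>. h (y \<theta>) (y \<omega>) \<theta> \<omega>)) \<ge> 0"
  using Xi2_quadratic_form[OF assms(1)]
proof cases
  case (1 P Q)
  have "integral {-\<tau>..0} (\<lambda>\<theta>. integral {-\<tau>..0} (\<lambda>\<omega>. h (y \<theta>) (y \<omega>) \<theta> \<omega>)) =
    (\<Sum>p\<in>P. \<Sum>q\<in>P. moment \<tau> (monomial (fst p)) (snd p) y *
       (Q p q * moment \<tau> (monomial (fst q)) (snd q) y))"
    using 1(1,3) assms(2) by (rule double_integral_eq)
  also have "\<dots> \<ge> 0"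
    using 1(2) unfolding psd_on_def by (simp add: mult.assoc)
  finally show ?thesis .
qed

text \<open>
  A double integral over a square that moves along the diagonal: the four sides give \<open>J\<close>, the
  interior gives the derivative of \<open>h\<close> in the direction \<open>(1, 1)\<close>. As a quadratic form in moments,
  the double integral is differentiated by the product rule.
\<close>

lemma double_integral_has_derivative:
  fixes h :: "real^'n \<Rightarrow> real^'n \<Rightarrow> real \<Rightarrow> real \<Rightarrow> real"
  assumes "\<tau> \<ge> 0" and h: "h \<in> Xi2 d" and x: "continuous_on {-\<tau>..} x" and t: "t \<ge> 0"
  obtains J where
    "((\<lambda>\<theta>. h (x t) (x (t + \<theta>)) 0 \<theta> - h (x (t - \<tau>)) (x (t + \<theta>)) (-\<tau>) \<theta>
         + h (x (t + \<theta>)) (x t) \<theta> 0 - h (x (t + \<theta>)) (x (t - \<tau>)) \<theta> (-\<tau>)) has_integral J) {-\<tau>..0}"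
    "((\<lambda>t. integral {-\<tau>..0} (\<lambda>\<theta>. integral {-\<tau>..0} (\<lambda>\<omega>. h (x (t + \<theta>)) (x (t + \<omega>)) \<theta> \<omega>)))
      has_real_derivative
      (J - integral {-\<tau>..0} (\<lambda>\<theta>. integral {-\<tau>..0} (\<lambda>\<omega>.
         deriv (\<lambda>s. h (x (t + \<theta>)) (x (t + \<omega>)) s \<omega>) \<theta> + deriv (\<lambda>s. h (x (t + \<theta>)) (x (t + \<omega>)) \<theta> s) \<omega>))))
      (at t within {0..})"
  using Xi2_quadratic_form[OF h]
proof cases
  case (1 P Q)
  note fin = 1(1) and heq = 1(3)
  define u where "u p = monomial (fst p)" for p :: "(real^'n \<Rightarrow> nat) \<times> nat"
  define k where "k p = snd p" for p :: "(real^'n \<Rightarrow> nat) \<times> nat"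
  let ?y = "\<lambda>\<theta>. x (t + \<theta>)"
  have contu: "continuous_on UNIV (u p)" for p unfolding u_def by (rule monomial_continuous)
  have y: "continuous_on {-\<tau>..0} (\<lambda>\<theta>. x (s + \<theta>))" if "s \<ge> 0" for s
    using x that by (rule continuous_on_history)
  define m where "m p = moment \<tau> (u p) (k p) ?y" for p
  define m' where "m' p = real (k p) * moment \<tau> (u p) (k p - 1) ?y" for p
  define e where "e p = u p (x t) * 0 ^ k p" for p
  define e' where "e' p = u p (x (t - \<tau>)) * (-\<tau>) ^ k p" for p
  have mi: "((\<lambda>\<theta>. u p (x (t + \<theta>)) * \<theta> ^ k p) has_integral m p) {-\<tau>..0}" for p
    unfolding m_def by (intro moment_has_integral contu y t)
  have mi': "((\<lambda>\<theta>. u p (x (t + \<theta>)) * (real (k p) * \<theta> ^ (k p - 1))) has_integral m' p) {-\<tau>..0}" for p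
    unfolding m'_def by (intro moment_scaled_has_integral contu y t)
  have h: "h x1 x2 \<theta> \<omega> = (\<Sum>p\<in>P. \<Sum>q\<in>P. (u p x1 * \<theta> ^ k p) * (Q p q * (u q x2 * \<omega> ^ k q)))"
    for x1 x2 \<theta> \<omega>
    unfolding heq u_def k_def ..
  define J where "J = (\<Sum>p\<in>P. \<Sum>q\<in>P. e p * (Q p q * m q)) - (\<Sum>p\<in>P. \<Sum>q\<in>P. e' p * (Q p q * m q))
    + (\<Sum>p\<in>P. \<Sum>q\<in>P. m p * (Q p q * e q)) - (\<Sum>p\<in>P. \<Sum>q\<in>P. m p * (Q p q * e' q))"
  have J: "((\<lambda>\<theta>. h (x t) (x (t + \<theta>)) 0 \<theta> - h (x (t - \<tau>)) (x (t + \<theta>)) (-\<tau>) \<theta>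
         + h (x (t + \<theta>)) (x t) \<theta> 0 - h (x (t + \<theta>)) (x (t - \<tau>)) \<theta> (-\<tau>)) has_integral J) {-\<tau>..0}"
    unfolding J_def h e_def[symmetric] e'_def[symmetric]
    by (intro has_integral_add has_integral_diff has_integral_sum has_integral_mult_left
        has_integral_mult_right mi fin)
  have d1: "deriv (\<lambda>s. h x1 x2 s \<omega>) \<theta> = (\<Sum>p\<in>P. \<Sum>q\<in>P.
      (u p x1 * (real (k p) * \<theta> ^ (k p - 1))) * (Q p q * (u q x2 * \<omega> ^ k q)))" for x1 x2 \<theta> \<omega>
    unfolding h by (rule DERIV_imp_deriv) (auto intro!: derivative_eq_intros simp: mult_ac)
  have d2: "deriv (\<lambda>s. h x1 x2 \<theta> s) \<omega> = (\<Sum>p\<in>P. \<Sum>q\<in>P.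
      (u p x1 * \<theta> ^ k p) * (Q p q * (u q x2 * (real (k q) * \<omega> ^ (k q - 1)))))" for x1 x2 \<theta> \<omega>
    unfolding h by (rule DERIV_imp_deriv) (auto intro!: derivative_eq_intros simp: mult_ac)
  have inner: "integral {-\<tau>..0} (\<lambda>\<omega>.
         deriv (\<lambda>s. h (x (t + \<theta>)) (x (t + \<omega>)) s \<omega>) \<theta> + deriv (\<lambda>s. h (x (t + \<theta>)) (x (t + \<omega>)) \<theta> s) \<omega>)
    = (\<Sum>p\<in>P. \<Sum>q\<in>P. (u p (x (t + \<theta>)) * (real (k p) * \<theta> ^ (k p - 1))) * (Q p q * m q)) +
      (\<Sum>p\<in>P. \<Sum>q\<in>P. (u p (x (t + \<theta>)) * \<theta> ^ k p) * (Q p q * m' q))" for \<theta>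
    unfolding d1 d2
    by (intro integral_unique has_integral_add has_integral_sum has_integral_mult_right mi mi' fin)
  have dbl: "integral {-\<tau>..0} (\<lambda>\<theta>. integral {-\<tau>..0} (\<lambda>\<omega>.
         deriv (\<lambda>s. h (x (t + \<theta>)) (x (t + \<omega>)) s \<omega>) \<theta> + deriv (\<lambda>s. h (x (t + \<theta>)) (x (t + \<omega>)) \<theta> s) \<omega>))
    = (\<Sum>p\<in>P. \<Sum>q\<in>P. m' p * (Q p q * m q)) + (\<Sum>p\<in>P. \<Sum>q\<in>P. m p * (Q p q * m' q))" (is "?D = _")
    unfolding inner
    by (intro integral_unique has_integral_add has_integral_sum has_integral_mult_left mi mi' fin)
  have mder: "((\<lambda>s. moment \<tau> (u p) (k p) (\<lambda>\<theta>. x (s + \<theta>))) has_real_derivative (e p - e' p - m' p))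
      (at t within {0..})" for p
    unfolding e_def e'_def m'_def by (intro moment_has_derivative assms contu)
  have "((\<lambda>s. \<Sum>p\<in>P. \<Sum>q\<in>P. moment \<tau> (u p) (k p) (\<lambda>\<theta>. x (s + \<theta>)) *
       (Q p q * moment \<tau> (u q) (k q) (\<lambda>\<theta>. x (s + \<theta>)))) has_real_derivative
       (\<Sum>p\<in>P. \<Sum>q\<in>P. m p * (Q p q * (e q - e' q - m' q)) + (e p - e' p - m' p) * (Q p q * m q)))
      (at t within {0..})"
    unfolding m_def by (intro DERIV_sum DERIV_mult' DERIV_cmult mder)
  also have "(\<Sum>p\<in>P. \<Sum>q\<in>P. m p * (Q p q * (e q - e' q - m' q)) + (e p - e' p - m' p) * (Q p q * m q)) = J - ?D"
    unfolding J_def dbl by (simp add: left_diff_distrib right_diff_distrib sum.distrib sum_subtractf)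
  finally have "((\<lambda>s. \<Sum>p\<in>P. \<Sum>q\<in>P. moment \<tau> (u p) (k p) (\<lambda>\<theta>. x (s + \<theta>)) *
       (Q p q * moment \<tau> (u q) (k q) (\<lambda>\<theta>. x (s + \<theta>)))) has_real_derivative (J - ?D)) (at t within {0..})" .
  then have "((\<lambda>t. integral {-\<tau>..0} (\<lambda>\<theta>. integral {-\<tau>..0} (\<lambda>\<omega>. h (x (t + \<theta>)) (x (t + \<omega>)) \<theta> \<omega>)))
      has_real_derivative (J - ?D)) (at t within {0..})"
    by (rule has_field_derivative_transform_within[where d = 1])
      (use t in \<open>auto simp: u_def k_def double_integral_eq[OF fin heq y]\<close>)
  with J show ?thesis by (rule that)
qed

section \<open>The Lyapunov functional\<close>

definition lyapunov where
  "lyapunov \<tau> g h y = integral {-\<tau>..0} (\<lambda>\<theta>. g (y 0) (y \<theta>) \<theta>)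
     + integral {-\<tau>..0} (\<lambda>\<theta>. integral {-\<tau>..0} (\<lambda>\<omega>. h (y \<theta>) (y \<omega>) \<theta> \<omega>))"
  for \<tau> :: real and g :: "'a \<Rightarrow> 'a \<Rightarrow> real \<Rightarrow> real" and h :: "'a \<Rightarrow> 'a \<Rightarrow> real \<Rightarrow> real \<Rightarrow> real"

text \<open>
  This filter is the neighbourhood filter of \<open>0\<close> in \<open>\<C>\<^sub>\<tau>\<close>, for functions of which only the
  restriction to \<open>{-\<tau>..0}\<close> matters. With it, continuity of a functional at the zero history is a
  plain limit, and a solution that converges to \<open>0\<close> is a map into this filter.
\<close>

definition small_histories :: "real \<Rightarrow> (real \<Rightarrow> 'a::real_normed_vector) filter" where
  "small_histories \<tau> =
     (INF e\<in>{0<..}. principal {y. continuous_on {-\<tau>..0} y \<and> (\<forall>\<theta>\<in>{-\<tau>..0}. norm (y \<theta>) < e)})"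

lemma eventually_small_histories:
  "eventually R (small_histories \<tau>) \<longleftrightarrow>
     (\<exists>e>0. \<forall>y. continuous_on {-\<tau>..0} y \<and> (\<forall>\<theta>\<in>{-\<tau>..0}. norm (y \<theta>) < e) \<longrightarrow> R y)"
  unfolding small_histories_def
proof (subst eventually_INF_base)
  fix a b :: real assume "a \<in> {0<..}" "b \<in> {0<..}"
  then show "\<exists>e\<in>{0<..}. principal {y. continuous_on {-\<tau>..0} y \<and> (\<forall>\<theta>\<in>{-\<tau>..0}. norm (y \<theta>) < e)}
     \<le> inf (principal {y. continuous_on {-\<tau>..0} y \<and> (\<forall>\<theta>\<in>{-\<tau>..0}. norm (y \<theta>) < a)})
         (principal {y. continuous_on {-\<tau>..0} y \<and> (\<forall>\<theta>\<in>{-\<tau>..0}. norm (y \<theta>) < b)})"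
    by (intro bexI[of _ "min a b"]) (auto simp: subset_iff)
qed (auto simp: eventually_principal)

lemma eventually_continuous_history:
  "\<forall>\<^sub>F y in small_histories \<tau>. continuous_on {-\<tau>..0} y"
  unfolding eventually_small_histories by (intro exI[of _ 1]) simp

lemma moment_tendsto:
  fixes b :: "'a::real_normed_vector \<Rightarrow> real"
  assumes "\<tau> \<ge> 0" "continuous_on UNIV b"
  shows "(moment \<tau> b k \<longlongrightarrow> moment \<tau> b k (\<lambda>_. 0)) (small_histories \<tau>)"
proof (rule tendstoI)
  fix e :: real assume "e > 0"
  define C where "C = \<tau> ^ k * \<tau> + 1"
  have C: "C > 0" unfolding C_def using assms by (simp add: add_nonneg_pos)
  have "isCont b 0" using assms(2) by (simp add: continuous_on_eq_continuous_at)
  then obtain \<delta> where "\<delta> > 0" and \<delta>: "\<And>z. norm z < \<delta> \<Longrightarrow> \<bar>b z - b 0\<bar> < e / C"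
    unfolding continuous_at_eps_delta dist_norm real_norm_def using divide_pos_pos[OF \<open>e > 0\<close> C]
    by (metis diff_zero)
  have "dist (moment \<tau> b k y) (moment \<tau> b k (\<lambda>_. 0)) < e"
    if y: "continuous_on {-\<tau>..0} y" and small: "\<forall>\<theta>\<in>{-\<tau>..0}. norm (y \<theta>) < \<delta>" for y
  proof -
    have "((\<lambda>\<theta>. b (y \<theta>) * \<theta> ^ k - b 0 * \<theta> ^ k) has_integral
        (moment \<tau> b k y - moment \<tau> b k (\<lambda>_. 0))) {-\<tau>..0}"
      by (intro has_integral_diff moment_has_integral assms y
          moment_has_integral[where y = "\<lambda>_. 0"] continuous_on_const)
    moreover have "norm (b (y \<theta>) * \<theta> ^ k - b 0 * \<theta> ^ k) \<le> e / C * \<tau> ^ k" if "\<theta> \<in> {-\<tau>..0}" for \<theta>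
    proof -
      have "norm (b (y \<theta>) * \<theta> ^ k - b 0 * \<theta> ^ k) = \<bar>b (y \<theta>) - b 0\<bar> * \<bar>\<theta>\<bar> ^ k"
        by (simp add: left_diff_distrib[symmetric] abs_mult power_abs)
      also have "\<dots> \<le> e / C * \<tau> ^ k"
        using that small \<open>e > 0\<close> C by (intro mult_mono power_mono less_imp_le[OF \<delta>]) auto
      finally show ?thesis .
    qed
    ultimately have "norm (moment \<tau> b k y - moment \<tau> b k (\<lambda>_. 0)) \<le> e / C * \<tau> ^ k * measure lborel {-\<tau>..0}"
      using \<open>e > 0\<close> C assms by (intro has_integral_bound_real) auto
    also have "\<dots> = e * (\<tau> ^ k * \<tau> / C)" using assms by simp
    also have "\<dots> < e * 1"
      using \<open>e > 0\<close> C by (intro mult_strict_left_mono) (auto simp: C_def)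
    finally show ?thesis by (simp add: dist_norm)
  qed
  then show "\<forall>\<^sub>F y in small_histories \<tau>. dist (moment \<tau> b k y) (moment \<tau> b k (\<lambda>_. 0)) < e"
    unfolding eventually_small_histories using \<open>\<delta> > 0\<close> by (intro exI[of _ \<delta>]) simp
qed

lemma tendsto_present:
  assumes "\<tau> \<ge> 0"
  shows "((\<lambda>y. y 0) \<longlongrightarrow> (0::'a::real_normed_vector)) (small_histories \<tau>)"
proof (rule tendstoI)
  fix e :: real assume "e > 0"
  with assms show "\<forall>\<^sub>F y in small_histories \<tau>. dist (y 0) (0::'a) < e"
    unfolding eventually_small_histories by (intro exI[of _ e]) simp
qed

lemma single_integral_tendsto:
  fixes g :: "'a::euclidean_space \<Rightarrow> 'a \<Rightarrow> real \<Rightarrow> real"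
  assumes "\<tau> \<ge> 0" and "poly_deg_le d (\<lambda>(x1, x2, \<theta>). g x1 x2 \<theta>)"
  shows "((\<lambda>y. integral {-\<tau>..0} (\<lambda>\<theta>. g (y 0) (y \<theta>) \<theta>)) \<longlongrightarrow> integral {-\<tau>..0} (\<lambda>\<theta>. g 0 0 \<theta>))
    (small_histories \<tau>)"
  using poly_deg_le_separable[OF assms(2)]
proof cases
  case (1 I A B k)
  note A = 1(2) and B = 1(3)
  have val: "integral {-\<tau>..0} (\<lambda>\<theta>. g z (y \<theta>) \<theta>) = (\<Sum>i\<in>I. A i z * moment \<tau> (B i) (k i) y)"
    if "continuous_on {-\<tau>..0} y" for z y
    by (rule single_integral_eq[OF 1(1,3,4) that])
  have contA: "isCont (A i) z" for i z
    using real_polynomial_function_continuous_on[OF A, of UNIV] by (simp add: continuous_on_eq_continuous_at)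
  have "((\<lambda>y. \<Sum>i\<in>I. A i (y 0) * moment \<tau> (B i) (k i) y) \<longlongrightarrow>
      (\<Sum>i\<in>I. A i 0 * moment \<tau> (B i) (k i) (\<lambda>_. 0))) (small_histories \<tau>)"
    by (intro tendsto_intros moment_tendsto isCont_tendsto_compose[OF contA] tendsto_present
        assms(1) real_polynomial_function_continuous_on B)
  moreover have "\<forall>\<^sub>F y in small_histories \<tau>.
      integral {-\<tau>..0} (\<lambda>\<theta>. g (y 0) (y \<theta>) \<theta>) = (\<Sum>i\<in>I. A i (y 0) * moment \<tau> (B i) (k i) y)"
    using eventually_continuous_history by eventually_elim (rule val)
  ultimately show ?thesis
    using val[of "\<lambda>_. 0" 0] by (simp add: tendsto_cong)
qed

lemma double_integral_tendsto:
  fixes h :: "real^'n \<Rightarrow> real^'n \<Rightarrow> real \<Rightarrow> real \<Rightarrow> real"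
  assumes "\<tau> \<ge> 0" and "h \<in> Xi2 d"
  shows "((\<lambda>y. integral {-\<tau>..0} (\<lambda>\<theta>. integral {-\<tau>..0} (\<lambda>\<omega>. h (y \<theta>) (y \<omega>) \<theta> \<omega>))) \<longlongrightarrow>
      integral {-\<tau>..0} (\<lambda>\<theta>. integral {-\<tau>..0} (\<lambda>\<omega>. h 0 0 \<theta> \<omega>))) (small_histories \<tau>)"
  using Xi2_quadratic_form[OF assms(2)]
proof cases
  case (1 P Q)
  note val = double_integral_eq[OF 1(1,3)]
  have "((\<lambda>y. \<Sum>p\<in>P. \<Sum>q\<in>P. moment \<tau> (monomial (fst p)) (snd p) y *
       (Q p q * moment \<tau> (monomial (fst q)) (snd q) y)) \<longlongrightarrow>
      (\<Sum>p\<in>P. \<Sum>q\<in>P. moment \<tau> (monomial (fst p)) (snd p) (\<lambda>_. 0) *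
       (Q p q * moment \<tau> (monomial (fst q)) (snd q) (\<lambda>_. 0)))) (small_histories \<tau>)"
    by (intro tendsto_intros moment_tendsto monomial_continuous assms(1))
  moreover have "\<forall>\<^sub>F y in small_histories \<tau>.
      integral {-\<tau>..0} (\<lambda>\<theta>. integral {-\<tau>..0} (\<lambda>\<omega>. h (y \<theta>) (y \<omega>) \<theta> \<omega>)) =
      (\<Sum>p\<in>P. \<Sum>q\<in>P. moment \<tau> (monomial (fst p)) (snd p) y *
       (Q p q * moment \<tau> (monomial (fst q)) (snd q) y))"
    using eventually_continuous_history by eventually_elim (rule val)
  ultimately show ?thesis
    using val[where y = "\<lambda>_. 0" and \<tau> = \<tau>] by (simp add: tendsto_cong)
qed

lemma sos_nonneg: "p \<in> sos \<Longrightarrow> p x \<ge> 0"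
  unfolding sos_def by (auto intro!: sum_list_nonneg)

lemma integral_lower_bound:
  fixes p q :: "real \<Rightarrow> real"
  assumes "\<tau> \<ge> 0" "continuous_on {-\<tau>..0} p" "continuous_on {-\<tau>..0} q"
    and "integral {-\<tau>..0} p = 0"
    and "\<And>\<theta>. \<theta> \<in> {-\<tau>..0} \<Longrightarrow> p \<theta> + c \<le> q \<theta>"
  shows "c * \<tau> \<le> integral {-\<tau>..0} q"
proof -
  have "(p has_integral 0) {-\<tau>..0}"
    using integrable_integral[OF integrable_continuous_real[OF assms(2)]] assms(4) by simp
  then have "((\<lambda>\<theta>. p \<theta> + c) has_integral 0 + (0 - - \<tau>) *\<^sub>R c) {-\<tau>..0}"
    using assms(1) by (intro has_integral_add has_integral_const_real[THEN has_integral_eq_rhs]) auto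
  from has_integral_le[OF this integrable_integral[OF integrable_continuous_real[OF assms(3)]] assms(5)]
  show ?thesis by (simp add: mult.commute)
qed

lemma Xi1_integral_bound:
  fixes g :: "real^'n \<Rightarrow> real^'n \<Rightarrow> real \<Rightarrow> real"
  assumes "\<tau> \<ge> 0" "g \<in> Xi1 \<tau> d"
  obtains \<alpha> where "\<alpha> > 0"
    "\<And>y. continuous_on {-\<tau>..0} y \<Longrightarrow>
       \<alpha> * \<tau> * (norm (y 0))\<^sup>2 \<le> integral {-\<tau>..0} (\<lambda>\<theta>. g (y 0) (y \<theta>) \<theta>)"
proof -
  obtain t \<alpha> where g: "poly_deg_le d (\<lambda>(x1, x2, \<theta>). g x1 x2 \<theta>)"
    and t: "poly_deg_le d (\<lambda>(x1, \<theta>). t x1 \<theta>)" and "\<alpha> > 0"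
    and sos: "(\<lambda>(x1, x2, \<theta>). g x1 x2 \<theta> - t x1 \<theta> - \<alpha> * (norm x1)\<^sup>2) \<in> sos"
    and t0: "\<And>x1. integral {-\<tau>..0} (\<lambda>\<theta>. t x1 \<theta>) = 0"
    using assms(2) unfolding Xi1_def by blast
  have le: "t x1 \<theta> + \<alpha> * (norm x1)\<^sup>2 \<le> g x1 x2 \<theta>" for x1 x2 \<theta>
    using sos_nonneg[OF sos, of "(x1, x2, \<theta>)"] by simp
  show ?thesis
  proof (rule that[OF \<open>\<alpha> > 0\<close>])
    fix y :: "real \<Rightarrow> real^'n" assume y: "continuous_on {-\<tau>..0} y"
    have ct: "continuous_on {-\<tau>..0} (\<lambda>\<theta>. t (y 0) \<theta>)"
      using continuous_on_compose2[OF poly_deg_le_continuous[OF t, of UNIV],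
          of "{-\<tau>..0}" "\<lambda>\<theta>. (y 0, \<theta>)"] by (simp add: continuous_intros)
    have cg: "continuous_on {-\<tau>..0} (\<lambda>\<theta>. g (y 0) (y \<theta>) \<theta>)"
      using continuous_on_compose2[OF poly_deg_le_continuous[OF g, of UNIV],
          of "{-\<tau>..0}" "\<lambda>\<theta>. (y 0, y \<theta>, \<theta>)"] y by (simp add: continuous_intros)
    show "\<alpha> * \<tau> * (norm (y 0))\<^sup>2 \<le> integral {-\<tau>..0} (\<lambda>\<theta>. g (y 0) (y \<theta>) \<theta>)"
      using integral_lower_bound[OF assms(1) ct cg t0 le] by (simp add: mult_ac)
  qed
qed

lemma Xi3_integral_bound:
  fixes q :: "real^'n \<Rightarrow> real^'n \<Rightarrow> real^'n \<Rightarrow> real \<Rightarrow> real"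
  assumes "\<tau> \<ge> 0" "q \<in> Xi3 \<tau> d"
  obtains \<alpha> where "\<alpha> > 0"
    "\<And>x1 x2 y. continuous_on {-\<tau>..0} y \<Longrightarrow>
       \<alpha> * \<tau> * (norm x1)\<^sup>2 \<le> integral {-\<tau>..0} (\<lambda>\<theta>. q x1 x2 (y \<theta>) \<theta>)"
proof -
  obtain t \<alpha> where q: "poly_deg_le d (\<lambda>(x1, x2, x3, \<theta>). q x1 x2 x3 \<theta>)"
    and t: "poly_deg_le d (\<lambda>(x1, x2, \<theta>). t x1 x2 \<theta>)" and "\<alpha> > 0"
    and sos: "(\<lambda>(x1, x2, x3, \<theta>). q x1 x2 x3 \<theta> - t x1 x2 \<theta> - \<alpha> * (norm x1)\<^sup>2) \<in> sos"
    and t0: "\<And>x1 x2. integral {-\<tau>..0} (\<lambda>\<theta>. t x1 x2 \<theta>) = 0"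
    using assms(2) unfolding Xi3_def by blast
  have le: "t x1 x2 \<theta> + \<alpha> * (norm x1)\<^sup>2 \<le> q x1 x2 x3 \<theta>" for x1 x2 x3 \<theta>
    using sos_nonneg[OF sos, of "(x1, x2, x3, \<theta>)"] by simp
  show ?thesis
  proof (rule that[OF \<open>\<alpha> > 0\<close>])
    fix x1 x2 and y :: "real \<Rightarrow> real^'n" assume y: "continuous_on {-\<tau>..0} y"
    have ct: "continuous_on {-\<tau>..0} (\<lambda>\<theta>. t x1 x2 \<theta>)"
      using continuous_on_compose2[OF poly_deg_le_continuous[OF t, of UNIV],
          of "{-\<tau>..0}" "\<lambda>\<theta>. (x1, x2, \<theta>)"] by (simp add: continuous_intros)
    have cq: "continuous_on {-\<tau>..0} (\<lambda>\<theta>. q x1 x2 (y \<theta>) \<theta>)"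
      using continuous_on_compose2[OF poly_deg_le_continuous[OF q, of UNIV],
          of "{-\<tau>..0}" "\<lambda>\<theta>. (x1, x2, y \<theta>, \<theta>)"] y by (simp add: continuous_intros)
    show "\<alpha> * \<tau> * (norm x1)\<^sup>2 \<le> integral {-\<tau>..0} (\<lambda>\<theta>. q x1 x2 (y \<theta>) \<theta>)"
      using integral_lower_bound[OF assms(1) ct cq t0 le] by (simp add: mult_ac)
  qed
qed

section \<open>A Lyapunov--Krasovskii criterion\<close>

lemma mvt_within_nonneg:
  fixes W :: "real \<Rightarrow> real"
  assumes "0 \<le> a" "a < b"
    and "\<And>s. s \<in> {a..b} \<Longrightarrow> (W has_real_derivative W' s) (at s within {0..})"
  obtains s where "a < s" "s < b" "W b - W a = W' s * (b - a)"
proof -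
  have "\<exists>s\<in>{a<..<b}. W b - W a = W' s * (b - a)"
    using assms(3) \<open>a < b\<close>
  proof (intro mvt_simple)
    fix s assume "a \<le> s" "s \<le> b"
    then have "(W has_real_derivative W' s) (at s within {a..b})"
      using assms(1) by (intro DERIV_subset[OF assms(3)]) auto
    then show "(W has_derivative (*) (W' s)) (at s within {a..b})"
      by (simp add: has_field_derivative_def)
  qed
  then show ?thesis using that by auto
qed

lemma lipschitz_of_bounded_speed:
  fixes x :: "real \<Rightarrow> 'a::real_normed_vector"
  assumes "0 \<le> a"
    and "\<And>s. s \<in> {a..b} \<Longrightarrow> (x has_vector_derivative x' s) (at s within {0..})"
    and "\<And>s. s \<in> {a..b} \<Longrightarrow> norm (x' s) \<le> M"
    and "r \<in> {a..b}" "s \<in> {a..b}"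
  shows "norm (x r - x s) \<le> M * \<bar>r - s\<bar>"
  unfolding real_norm_def[symmetric]
proof (rule differentiable_bound[where S = "{a..b}" and f' = "\<lambda>s h. h *\<^sub>R x' s"])
  fix s assume s: "s \<in> {a..b}"
  then have "(x has_vector_derivative x' s) (at s within {a..b})"
    using assms(1) by (intro has_vector_derivative_within_subset[OF assms(2)]) auto
  then show "(x has_derivative (\<lambda>h. h *\<^sub>R x' s)) (at s within {a..b})"
    by (simp add: has_vector_derivative_def)
  show "onorm (\<lambda>h. h *\<^sub>R x' s) \<le> M"
    using assms(3)[OF s] by (intro onorm_le) (simp add: mult.commute[of M] mult_left_mono)
qed (use assms in auto)

text \<open>
  If \<open>x\<close> moves at speed at most \<open>M\<close> and has norm at least \<open>e\<close> at time \<open>T\<close>, then its norm was at least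
  \<open>e / 2\<close> during the preceding time \<open>e / (2 * M)\<close>. An energy with dissipation \<open>\<alpha> * (norm x)\<^sup>2\<close>
  therefore lost a fixed amount during that time.
\<close>

lemma energy_drop:
  fixes x :: "real \<Rightarrow> 'a::real_normed_vector" and W :: "real \<Rightarrow> real"
  assumes "e > 0" "M > 0" "\<alpha> \<ge> 0" "T - e / (2 * M) \<ge> 0"
    and x: "\<And>s. s \<in> {T - e / (2 * M)..T} \<Longrightarrow> (x has_vector_derivative x' s) (at s within {0..})"
    and x': "\<And>s. s \<in> {T - e / (2 * M)..T} \<Longrightarrow> norm (x' s) \<le> M"
    and W: "\<And>s. s \<in> {T - e / (2 * M)..T} \<Longrightarrow> (W has_real_derivative W' s) (at s within {0..})"
    and W': "\<And>s. s \<in> {T - e / (2 * M)..T} \<Longrightarrow> W' s \<le> - \<alpha> * (norm (x s))\<^sup>2"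
    and e: "e \<le> norm (x T)"
  shows "W T \<le> W (T - e / (2 * M)) - \<alpha> * (e / 2)\<^sup>2 * (e / (2 * M))"
proof -
  define l where "l = e / (2 * M)"
  note in_l = x[folded l_def] x'[folded l_def] W[folded l_def]
  have l: "l > 0" "M * l = e / 2" "T - l \<ge> 0" using assms by (auto simp: l_def)
  obtain s where s: "T - l < s" "s < T" "W T - W (T - l) = W' s * (T - (T - l))"
    by (rule mvt_within_nonneg[of "T - l" T W W']) (use l in_l in auto)
  have "norm (x T - x s) \<le> M * \<bar>T - s\<bar>"
    using s l by (intro lipschitz_of_bounded_speed[OF l(3) in_l(1,2)]) auto
  also have "\<dots> \<le> M * l" using s assms by (intro mult_left_mono) auto
  finally have "norm (x T) - norm (x s) \<le> e / 2"
    using norm_triangle_ineq2[of "x T" "x s"] l by linarith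
  then have "(e / 2)\<^sup>2 \<le> (norm (x s))\<^sup>2"
    using e assms by (intro power_mono) auto
  then have "\<alpha> * (e / 2)\<^sup>2 \<le> \<alpha> * (norm (x s))\<^sup>2" using assms by (intro mult_left_mono)
  moreover have "W' s \<le> - \<alpha> * (norm (x s))\<^sup>2" using s by (intro W') (auto simp: l_def)
  ultimately have "W' s * l \<le> - (\<alpha> * (e / 2)\<^sup>2) * l"
    using l by (intro mult_right_mono) auto
  then show ?thesis using s by (simp add: l_def)
qed

text \<open>
  Were \<open>norm (x T) \<ge> e\<close> for arbitrarily large \<open>T\<close>, the energy \<open>W\<close> would fall below its
  infimum: once \<open>W\<close> is within \<open>c\<close> of the infimum, a drop by \<open>c\<close> is no longer possible.
\<close>

lemma decreasing_energy_imp_tendsto: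
  fixes x :: "real \<Rightarrow> 'a::real_normed_vector" and W :: "real \<Rightarrow> real"
  assumes "M > 0" "\<alpha> > 0"
    and x: "\<And>t. t \<ge> 0 \<Longrightarrow> (x has_vector_derivative x' t) (at t within {0..})"
    and x': "\<And>t. t \<ge> 0 \<Longrightarrow> norm (x' t) \<le> M"
    and W: "\<And>t. t \<ge> 0 \<Longrightarrow> (W has_real_derivative W' t) (at t within {0..})"
    and W': "\<And>t. t \<ge> 0 \<Longrightarrow> W' t \<le> - \<alpha> * (norm (x t))\<^sup>2"
    and mono: "\<And>s t. 0 \<le> s \<Longrightarrow> s \<le> t \<Longrightarrow> W t \<le> W s"
    and nonneg: "\<And>t. t \<ge> 0 \<Longrightarrow> W t \<ge> 0"
  shows "(x \<longlongrightarrow> 0) at_top"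
proof (rule tendstoI)
  fix e :: real assume "e > 0"
  define l where "l = e / (2 * M)"
  define c where "c = \<alpha> * (e / 2)\<^sup>2 * l"
  have "l > 0" "c > 0" using assms \<open>e > 0\<close> by (auto simp: l_def c_def)
  define L where "L = (INF t\<in>{0..}. W t)"
  have bdd: "bdd_below (W ` {0..})" using nonneg by (auto intro!: bdd_belowI)
  have L: "L \<le> W t" if "t \<ge> 0" for t
    unfolding L_def using bdd that by (intro cINF_lower) auto
  obtain t0 where t0: "t0 \<ge> 0" "W t0 < L + c"
    using cINF_less_iff[of "{0..}" W "L + c"] bdd \<open>c > 0\<close> unfolding L_def by auto
  have "norm (x T) < e" if T: "T \<ge> t0 + l" for T
  proof (rule ccontr)
    assume "\<not> norm (x T) < e"
    then have "W T \<le> W (T - l) - c"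
      unfolding c_def l_def using assms t0 T \<open>e > 0\<close> \<open>l > 0\<close>
      by (intro energy_drop[where x = x and x' = x' and W' = W']) (auto simp: l_def)
    moreover have "W (T - l) \<le> W t0" using t0 T by (intro mono) auto
    moreover have "L \<le> W T" using t0 T \<open>l > 0\<close> by (intro L) auto
    ultimately show False using t0 by simp
  qed
  then show "\<forall>\<^sub>F t in at_top. dist (x t) 0 < e"
    by (auto simp: eventually_at_top_linorder)
qed

lemma bounded_rhs:
  fixes f :: "'a::euclidean_space \<Rightarrow> 'a \<Rightarrow> 'a"
  assumes "continuous_on UNIV (\<lambda>(x, y). f x y)"
  obtains M where "M > 0" "\<And>a b. norm a \<le> R \<Longrightarrow> norm b \<le> R \<Longrightarrow> norm (f a b) \<le> M"
proof -
  have "compact ((\<lambda>(x, y). f x y) ` (cball 0 R \<times> cball 0 R))"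
    by (intro compact_continuous_image continuous_on_subset[OF assms] compact_Times) auto
  then obtain M where "M > 0" "\<And>z. z \<in> (\<lambda>(x, y). f x y) ` (cball 0 R \<times> cball 0 R) \<Longrightarrow> norm z \<le> M"
    using bounded_pos compact_imp_bounded by metis
  then show ?thesis using that[of M] by force
qed

text \<open>
  As \<open>V (\<lambda>_. 0)\<close> may be positive, the lower bound on \<open>V\<close> only serves to bound the solutions; the
  comparison of \<open>V\<close> with its value at the zero history comes from the convergence of the
  solutions to \<open>0\<close>.
\<close>

lemma Lyapunov_Krasovskii:
  fixes f :: "real^'n \<Rightarrow> real^'n \<Rightarrow> real^'n" and V :: "(real \<Rightarrow> real^'n) \<Rightarrow> real"
  assumes "\<tau> > 0" and f: "continuous_on UNIV (\<lambda>(x, y). f x y)" and "\<alpha> > 0" "\<beta> > 0"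
    and lower: "\<And>y. continuous_on {-\<tau>..0} y \<Longrightarrow> \<beta> * (norm (y 0))\<^sup>2 \<le> V y"
    and decay: "\<And>x t. continuous_on {-\<tau>..} x \<Longrightarrow> t \<ge> 0 \<Longrightarrow>
      (x has_vector_derivative f (x t) (x (t - \<tau>))) (at t within {0..}) \<Longrightarrow>
      \<exists>D. ((\<lambda>s. V (\<lambda>\<theta>. x (s + \<theta>))) has_real_derivative D) (at t within {0..}) \<and> D \<le> - \<alpha> * (norm (x t))\<^sup>2"
    and lim: "(V \<longlongrightarrow> V (\<lambda>_. 0)) (small_histories \<tau>)"
  shows "delay_gas f \<tau>"
proof -
  have sol: "bounded (x ` {-\<tau>..}) \<and> (x \<longlongrightarrow> 0) at_top \<and>
      (\<exists>W'. (\<forall>t\<ge>0. ((\<lambda>s. V (\<lambda>\<theta>. x (s + \<theta>))) has_real_derivative W' t) (at t within {0..}) \<and>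
             W' t \<le> - \<alpha> * (norm (x t))\<^sup>2)) \<and>
      (\<forall>s t. 0 \<le> s \<longrightarrow> s \<le> t \<longrightarrow> V (\<lambda>\<theta>. x (t + \<theta>)) \<le> V (\<lambda>\<theta>. x (s + \<theta>))) \<and>
      (\<forall>t\<ge>0. V (\<lambda>_. 0) \<le> V (\<lambda>\<theta>. x (t + \<theta>)))"
    if "delay_sol f \<tau> \<phi> x" for \<phi> x
  proof -
    define W where "W = (\<lambda>t. V (\<lambda>\<theta>. x (t + \<theta>)))"
    have cont: "continuous_on {-\<tau>..} x"
      and x: "\<And>t. t \<ge> 0 \<Longrightarrow> (x has_vector_derivative f (x t) (x (t - \<tau>))) (at t within {0..})"
      using that by (auto simp: delay_sol_def)
    obtain W' where W: "\<And>t. t \<ge> 0 \<Longrightarrow> (W has_real_derivative W' t) (at t within {0..})"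
      and W': "\<And>t. t \<ge> 0 \<Longrightarrow> W' t \<le> - \<alpha> * (norm (x t))\<^sup>2"
      using decay[OF cont _ x] unfolding W_def by metis
    have W'0: "W' t \<le> 0" if "t \<ge> 0" for t
      using W'[OF that] \<open>\<alpha> > 0\<close> by (smt (verit) mult_minus_left mult_nonneg_nonneg zero_le_power2)
    have mono: "W t \<le> W s" if st: "0 \<le> s" "s \<le> t" for s t
    proof (cases "s = t")
      case False
      obtain r where "s < r" "r < t" "W t - W s = W' r * (t - s)"
        by (rule mvt_within_nonneg[of s t W W']) (use st False W in auto)
      then show ?thesis using W'0[of r] st mult_nonpos_nonneg[of "W' r" "t - s"] by auto
    qed simp
    have low: "\<beta> * (norm (x t))\<^sup>2 \<le> W t" if "t \<ge> 0" for t
      using lower[OF continuous_on_history[OF cont that]] by (simp add: W_def)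
    have nonneg: "0 \<le> W t" if "t \<ge> 0" for t
      using low[OF that] \<open>\<beta> > 0\<close> by (smt (verit) mult_nonneg_nonneg zero_le_power2)
    have "norm (x t) \<le> sqrt (W 0 / \<beta>)" if "t \<ge> 0" for t
    proof (rule real_le_rsqrt)
      have "\<beta> * (norm (x t))\<^sup>2 \<le> W 0" using low[OF that] mono[of 0 t] that by simp
      then show "(norm (x t))\<^sup>2 \<le> W 0 / \<beta>" using \<open>\<beta> > 0\<close> by (simp add: field_simps)
    qed
    then have "bounded (x ` {0..})" by (auto simp: bounded_iff)
    moreover have "bounded (x ` {-\<tau>..0})"
      by (intro compact_imp_bounded compact_continuous_image continuous_on_subset[OF cont]) auto
    moreover have "{-\<tau>..} = {-\<tau>..0} \<union> {0..}" using \<open>\<tau> > 0\<close> by auto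
    ultimately have bdd: "bounded (x ` {-\<tau>..})" by (metis bounded_Un image_Un)
    then obtain R where R: "\<And>t. t \<ge> -\<tau> \<Longrightarrow> norm (x t) \<le> R" by (auto simp: bounded_iff)
    obtain M where M: "M > 0" "\<And>a b. norm a \<le> R \<Longrightarrow> norm b \<le> R \<Longrightarrow> norm (f a b) \<le> M"
      using bounded_rhs[OF f] by blast
    have lim0: "(x \<longlongrightarrow> 0) at_top"
    proof (rule decreasing_energy_imp_tendsto[OF M(1) \<open>\<alpha> > 0\<close> x _ W W' mono nonneg])
      show "norm (f (x t) (x (t - \<tau>))) \<le> M" if "t \<ge> 0" for t
        using \<open>\<tau> > 0\<close> that by (intro M R) auto
    qed
    \<comment> \<open>The whole history becomes small once \<open>x\<close> has been small for the time \<open>\<tau>\<close>.\<close>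
    have "filterlim (\<lambda>t \<theta>. x (t + \<theta>)) (small_histories \<tau>) at_top"
      unfolding filterlim_iff
    proof (intro allI impI)
      fix R assume "eventually R (small_histories \<tau> :: (real \<Rightarrow> real^'n) filter)"
      then obtain e where "e > 0" and e: "\<And>y. continuous_on {-\<tau>..0} y \<Longrightarrow>
          (\<And>\<theta>. \<theta> \<in> {-\<tau>..0} \<Longrightarrow> norm (y \<theta>) < e) \<Longrightarrow> R y"
        unfolding eventually_small_histories by blast
      obtain t0 where t0: "\<And>t. t \<ge> t0 \<Longrightarrow> norm (x t) < e"
        using tendstoD[OF lim0 \<open>e > 0\<close>] by (auto simp: eventually_at_top_linorder)
      have "R (\<lambda>\<theta>. x (t + \<theta>))" if "t \<ge> max 0 (t0 + \<tau>)" for t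
        using that by (intro e continuous_on_history[OF cont] t0) auto
      then show "\<forall>\<^sub>F t in at_top. R (\<lambda>\<theta>. x (t + \<theta>))"
        unfolding eventually_at_top_linorder by blast
    qed
    then have "(W \<longlongrightarrow> V (\<lambda>_. 0)) at_top"
      unfolding W_def by (rule filterlim_compose[OF lim])
    then have "V (\<lambda>_. 0) \<le> W t" if "t \<ge> 0" for t
      using mono that
      by (intro tendsto_upperbound[of W _ at_top]) (auto simp: eventually_at_top_linorder)
    then show ?thesis using bdd lim0 W W' mono unfolding W_def by blast
  qed
  have stable: "\<exists>\<delta>>0. \<forall>\<phi> x. continuous_on {-\<tau>..0} \<phi> \<and> delay_sol f \<tau> \<phi> x \<and>
      (SUP \<theta>\<in>{-\<tau>..0}. norm (\<phi> \<theta>)) < \<delta> \<longrightarrow> (SUP t\<in>{-\<tau>..}. norm (x t)) < \<epsilon>" if "\<epsilon> > 0" for \<epsilon>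
  proof -
    define e where "e = \<epsilon> / 2"
    have "e > 0" "e < \<epsilon>" using that by (auto simp: e_def)
    obtain M where M: "M > 0" "\<And>a b. norm a \<le> e \<Longrightarrow> norm b \<le> e \<Longrightarrow> norm (f a b) \<le> M"
      using bounded_rhs[OF f] by blast
    define l where "l = e / (2 * M)"
    \<comment> \<open>\<open>c\<close> is the energy that an excursion to norm \<open>e\<close> costs by \<open>energy_drop\<close>.\<close>
    define c where "c = \<alpha> * (e / 2)\<^sup>2 * l"
    have l: "l > 0" "M * l = e / 2" and "c > 0"
      using \<open>e > 0\<close> M(1) \<open>\<alpha> > 0\<close> by (auto simp: l_def c_def)
    have "\<forall>\<^sub>F y in small_histories \<tau>. V y < V (\<lambda>_. 0) + c"
      using \<open>c > 0\<close> by (intro order_tendstoD(2)[OF lim]) auto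
    then obtain \<delta>0 where "\<delta>0 > 0" and \<delta>0: "\<And>y. continuous_on {-\<tau>..0} y \<Longrightarrow>
        (\<And>\<theta>. \<theta> \<in> {-\<tau>..0} \<Longrightarrow> norm (y \<theta>) < \<delta>0) \<Longrightarrow> V y < V (\<lambda>_. 0) + c"
      unfolding eventually_small_histories by blast
    define \<delta> where "\<delta> = min \<delta>0 (e / 2)"
    have "(SUP t\<in>{-\<tau>..}. norm (x t)) < \<epsilon>"
      if \<phi>: "continuous_on {-\<tau>..0} \<phi>" and "delay_sol f \<tau> \<phi> x"
        and small: "(SUP \<theta>\<in>{-\<tau>..0}. norm (\<phi> \<theta>)) < \<delta>" for \<phi> x
    proof -
      have cont: "continuous_on {-\<tau>..} x" and init: "\<And>\<theta>. \<theta> \<in> {-\<tau>..0} \<Longrightarrow> x \<theta> = \<phi> \<theta>"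
        and x: "\<And>t. t \<ge> 0 \<Longrightarrow> (x has_vector_derivative f (x t) (x (t - \<tau>))) (at t within {0..})"
        using that by (auto simp: delay_sol_def)
      define W where "W = (\<lambda>t. V (\<lambda>\<theta>. x (t + \<theta>)))"
      obtain W' where W: "\<And>t. t \<ge> 0 \<Longrightarrow> (W has_real_derivative W' t) (at t within {0..})"
        and W': "\<And>t. t \<ge> 0 \<Longrightarrow> W' t \<le> - \<alpha> * (norm (x t))\<^sup>2"
        and mono: "\<And>s t. 0 \<le> s \<Longrightarrow> s \<le> t \<Longrightarrow> W t \<le> W s"
        and V0: "\<And>t. t \<ge> 0 \<Longrightarrow> V (\<lambda>_. 0) \<le> W t"
        using sol[OF \<open>delay_sol f \<tau> \<phi> x\<close>] unfolding W_def by blast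
      have "bdd_above ((\<lambda>\<theta>. norm (\<phi> \<theta>)) ` {-\<tau>..0})"
        by (intro compact_imp_bounded[THEN bounded_imp_bdd_above] compact_continuous_image
            continuous_on_norm \<phi>) auto
      then have initial: "norm (x \<theta>) < \<delta>" if "\<theta> \<in> {-\<tau>..0}" for \<theta>
        using cSUP_upper[OF that, of "\<lambda>\<theta>. norm (\<phi> \<theta>)"] small init[OF that] by simp
      have "W 0 < V (\<lambda>_. 0) + c"
        unfolding W_def using initial
        by (intro \<delta>0 continuous_on_history[OF cont]) (auto simp: \<delta>_def)
      have "norm (x t) < e" if "t \<ge> -\<tau>" for t
      proof (rule ccontr)
        assume "\<not> norm (x t) < e"
        \<comment> \<open>\<open>T\<close> is the first time at which the norm reaches \<open>e\<close>; up to then, the bound \<open>M\<close> on the speed holds.\<close>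
        define S where "S = {-\<tau>..t} \<inter> (\<lambda>s. norm (x s)) -` {e..}"
        have "closed S"
          unfolding S_def
          by (intro continuous_closed_preimage continuous_on_norm continuous_on_subset[OF cont]) auto
        then have "compact S"
          using bounded_subset[of "{-\<tau>..t}" S] by (auto simp: S_def compact_eq_bounded_closed)
        moreover have "S \<noteq> {}" using \<open>\<not> norm (x t) < e\<close> that by (auto simp: S_def)
        ultimately obtain T where T: "T \<in> S" "\<And>s. s \<in> S \<Longrightarrow> T \<le> s"
          using compact_attains_inf by metis
        have before: "norm (x s) \<le> e" if "-\<tau> \<le> s" "s < T" for s
          using T(2)[of s] T(1) that by (force simp: S_def)
        have "T > 0"
          using initial[of T] T(1) \<open>e > 0\<close> by (force simp: S_def \<delta>_def)
        have "norm (x 0) < e / 2" using initial[of 0] \<open>\<tau> > 0\<close> by (auto simp: \<delta>_def)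
        obtain s where s: "0 \<le> s" "s \<le> T" "norm (x s) = e"
        proof -
          have "\<exists>s\<ge>0. s \<le> T \<and> norm (x s) = e"
            using \<open>norm (x 0) < e / 2\<close> T(1) \<open>T > 0\<close> \<open>\<tau> > 0\<close> \<open>e > 0\<close>
            by (intro IVT' continuous_on_norm continuous_on_subset[OF cont]) (auto simp: S_def)
          then show ?thesis using that by blast
        qed
        then have "s \<in> S" using T(1) \<open>\<tau> > 0\<close> by (auto simp: S_def)
        then have xT: "norm (x T) = e" using T(2) s by force
        have speed: "norm (f (x s) (x (s - \<tau>))) \<le> M" if "s \<in> {0..T}" for s
          using that \<open>\<tau> > 0\<close> before[of s] before[of "s - \<tau>"] xT
          by (intro M) (cases "s = T"; auto)+
        \<comment> \<open>Starting from norm below \<open>e / 2\<close>, it takes longer than \<open>l\<close> to reach norm \<open>e\<close>.\<close>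
        have "norm (x T - x 0) \<le> M * \<bar>T - 0\<bar>"
          using \<open>T > 0\<close> by (intro lipschitz_of_bounded_speed[OF _ x speed]) auto
        then have "M * l < M * T"
          using norm_triangle_ineq2[of "x T" "x 0"] xT \<open>norm (x 0) < e / 2\<close> \<open>T > 0\<close> l(2) by simp
        then have "l < T" using M(1) by simp
        then have "W T \<le> W (T - l) - c"
          unfolding c_def l_def using \<open>e > 0\<close> M(1) \<open>\<alpha> > 0\<close> xT l(1)
          by (intro energy_drop[OF _ _ _ _ x speed W W']) (auto simp: l_def)
        moreover have "W (T - l) \<le> W 0" using \<open>l < T\<close> by (intro mono) auto
        moreover have "V (\<lambda>_. 0) \<le> W T" using \<open>T > 0\<close> by (intro V0) auto
        ultimately show False using \<open>W 0 < V (\<lambda>_. 0) + c\<close> by simp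
      qed
      then have "(SUP t\<in>{-\<tau>..}. norm (x t)) \<le> e"
        by (intro cSUP_least) (auto intro: less_imp_le)
      then show ?thesis using \<open>e < \<epsilon>\<close> by simp
    qed
    moreover have "\<delta> > 0" using \<open>\<delta>0 > 0\<close> \<open>e > 0\<close> by (simp add: \<delta>_def)
    ultimately show ?thesis by blast
  qed
  show ?thesis
    unfolding delay_gas_def using sol stable by blast
qed

section \<open>Stability of the time-delay system\<close>

theorem mainTheorem8:
  fixes \<tau> :: real and d :: nat
    and f :: "real^'n \<Rightarrow> real^'n \<Rightarrow> real^'n"
    and g :: "real^'n \<Rightarrow> real^'n \<Rightarrow> real \<Rightarrow> real"
    and g' :: "real^'n \<Rightarrow> real^'n \<Rightarrow> real^'n \<Rightarrow> real \<Rightarrow> real"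
    and h h' :: "real^'n \<Rightarrow> real^'n \<Rightarrow> real \<Rightarrow> real \<Rightarrow> real"
  assumes "\<tau> > 0"
    and "continuous_on UNIV (\<lambda>(x, y). f x y)" and "f 0 0 = 0"
    and "delay_unique_sol f \<tau>"
    and "even d"
    and "g \<in> Xi1 \<tau> d" and "h \<in> Xi2 d" and "h' \<in> Xi2 d"
    and "(\<lambda>x1 x2 x3 \<theta>. - g' x1 x2 x3 \<theta>) \<in> Xi3 \<tau> d"
    and "\<And>x1 x2 x3 \<theta>. \<theta> \<in> {-\<tau>..0} \<Longrightarrow>
      g' x1 x2 x3 \<theta> =
        g x1 x1 0 - g x1 x2 (-\<tau>)
        + \<tau> * (gradient (\<lambda>y. g y x3 \<theta>) x1 \<bullet> f x1 x2)
        - \<tau> * deriv (\<lambda>s. g x1 x3 s) \<theta>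
        + \<tau> * h x1 x3 0 \<theta> - \<tau> * h x2 x3 (-\<tau>) \<theta>
        + \<tau> * h x3 x1 \<theta> 0 - \<tau> * h x3 x2 \<theta> (-\<tau>)"
    and "\<And>x1 x2 \<theta> \<omega>. \<theta> \<in> {-\<tau>..0} \<Longrightarrow> \<omega> \<in> {-\<tau>..0} \<Longrightarrow>
      h' x1 x2 \<theta> \<omega> = deriv (\<lambda>s. h x1 x2 s \<omega>) \<theta> + deriv (\<lambda>s. h x1 x2 \<theta> s) \<omega>"
  shows "delay_gas f \<tau>"
proof -
  note \<tau> = \<open>\<tau> > 0\<close> less_imp_le[OF \<open>\<tau> > 0\<close>] and g'_eq = assms(10) and h'_eq = assms(11)
  have g_poly: "poly_deg_le d (\<lambda>(x1, x2, \<theta>). g x1 x2 \<theta>)"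
    using \<open>g \<in> Xi1 \<tau> d\<close> by (simp add: Xi1_def)
  obtain \<alpha> where "\<alpha> > 0" and \<alpha>: "\<And>y. continuous_on {-\<tau>..0} y \<Longrightarrow>
      \<alpha> * \<tau> * (norm (y 0))\<^sup>2 \<le> integral {-\<tau>..0} (\<lambda>\<theta>. g (y 0) (y \<theta>) \<theta>)"
    using Xi1_integral_bound[OF \<tau>(2) \<open>g \<in> Xi1 \<tau> d\<close>] by metis
  obtain \<gamma> where "\<gamma> > 0" and \<gamma>: "\<And>x1 x2 y. continuous_on {-\<tau>..0} y \<Longrightarrow>
      \<gamma> * \<tau> * (norm x1)\<^sup>2 \<le> integral {-\<tau>..0} (\<lambda>\<theta>. - g' x1 x2 (y \<theta>) \<theta>)"
    using Xi3_integral_bound[OF \<tau>(2) assms(9)] by metis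
  show ?thesis
  proof (rule Lyapunov_Krasovskii[where V = "lyapunov \<tau> g h" and \<alpha> = \<gamma> and \<beta> = "\<alpha> * \<tau>"])
    show "\<alpha> * \<tau> * (norm (y 0))\<^sup>2 \<le> lyapunov \<tau> g h y" if "continuous_on {-\<tau>..0} y" for y
      using \<alpha>[OF that] Xi2_double_integral_nonneg[OF \<open>h \<in> Xi2 d\<close> that] by (simp add: lyapunov_def)
    show "(lyapunov \<tau> g h \<longlongrightarrow> lyapunov \<tau> g h (\<lambda>_. 0)) (small_histories \<tau>)"
      unfolding lyapunov_def
      by (intro tendsto_add single_integral_tendsto[OF \<tau>(2) g_poly]
          double_integral_tendsto[OF \<tau>(2) \<open>h \<in> Xi2 d\<close>])
  next
    fix x :: "real \<Rightarrow> real^'n" and t :: real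
    assume x: "continuous_on {-\<tau>..} x" and t: "t \<ge> 0"
      and x': "(x has_vector_derivative f (x t) (x (t - \<tau>))) (at t within {0..})"
    let ?y = "\<lambda>\<theta>. x (t + \<theta>)"
    have y: "continuous_on {-\<tau>..0} ?y" using x t by (rule continuous_on_history)
    obtain J1 where J1: "((\<lambda>\<theta>. gradient (\<lambda>y. g y (?y \<theta>) \<theta>) (x t) \<bullet> f (x t) (x (t - \<tau>))
          - deriv (\<lambda>s. g (x t) (?y \<theta>) s) \<theta>) has_integral J1) {-\<tau>..0}"
      and D1: "((\<lambda>t. integral {-\<tau>..0} (\<lambda>\<theta>. g (x t) (x (t + \<theta>)) \<theta>)) has_real_derivative
          (g (x t) (x t) 0 - g (x t) (x (t - \<tau>)) (-\<tau>) + J1)) (at t within {0..})"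
      by (rule single_integral_has_derivative[OF \<tau>(2) g_poly x t x'])
    obtain J2 where J2: "((\<lambda>\<theta>. h (x t) (?y \<theta>) 0 \<theta> - h (x (t - \<tau>)) (?y \<theta>) (-\<tau>) \<theta>
           + h (?y \<theta>) (x t) \<theta> 0 - h (?y \<theta>) (x (t - \<tau>)) \<theta> (-\<tau>)) has_integral J2) {-\<tau>..0}"
      and D2: "((\<lambda>t. integral {-\<tau>..0} (\<lambda>\<theta>. integral {-\<tau>..0} (\<lambda>\<omega>. h (x (t + \<theta>)) (x (t + \<omega>)) \<theta> \<omega>)))
        has_real_derivative
        (J2 - integral {-\<tau>..0} (\<lambda>\<theta>. integral {-\<tau>..0} (\<lambda>\<omega>.
           deriv (\<lambda>s. h (?y \<theta>) (?y \<omega>) s \<omega>) \<theta> + deriv (\<lambda>s. h (?y \<theta>) (?y \<omega>) \<theta> s) \<omega>))))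
        (at t within {0..})"
      by (rule double_integral_has_derivative[OF \<tau>(2) \<open>h \<in> Xi2 d\<close> x t])
    let ?b = "g (x t) (x t) 0 - g (x t) (x (t - \<tau>)) (-\<tau>)"
    let ?H = "integral {-\<tau>..0} (\<lambda>\<theta>. integral {-\<tau>..0} (\<lambda>\<omega>. h' (?y \<theta>) (?y \<omega>) \<theta> \<omega>))"
    \<comment> \<open>Integrating the identity for \<open>g'\<close> over \<open>\<theta>\<close> reproduces \<open>\<tau>\<close> times the derivative, up to the double integral.\<close>
    have "((\<lambda>\<theta>. ?b + \<tau> * (gradient (\<lambda>y. g y (?y \<theta>) \<theta>) (x t) \<bullet> f (x t) (x (t - \<tau>))
          - deriv (\<lambda>s. g (x t) (?y \<theta>) s) \<theta>)
          + \<tau> * (h (x t) (?y \<theta>) 0 \<theta> - h (x (t - \<tau>)) (?y \<theta>) (-\<tau>) \<theta>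
           + h (?y \<theta>) (x t) \<theta> 0 - h (?y \<theta>) (x (t - \<tau>)) \<theta> (-\<tau>)))
        has_integral (0 - - \<tau>) *\<^sub>R ?b + \<tau> * J1 + \<tau> * J2) {-\<tau>..0}"
      using \<tau> by (intro has_integral_add has_integral_mult_right J1 J2
          has_integral_const_real[THEN has_integral_eq_rhs]) auto
    then have "((\<lambda>\<theta>. g' (x t) (x (t - \<tau>)) (?y \<theta>) \<theta>) has_integral
        (0 - - \<tau>) *\<^sub>R ?b + \<tau> * J1 + \<tau> * J2) {-\<tau>..0}"
      by (rule has_integral_eq[rotated]) (simp add: g'_eq algebra_simps)
    then have "integral {-\<tau>..0} (\<lambda>\<theta>. - g' (x t) (x (t - \<tau>)) (?y \<theta>) \<theta>) = - (\<tau> * (?b + J1 + J2))"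
      by (simp add: integral_unique algebra_simps)
    then have "\<tau> * (?b + J1 + J2) \<le> \<tau> * (- \<gamma> * (norm (x t))\<^sup>2)"
      using \<gamma>[OF y, of "x t" "x (t - \<tau>)"] by (simp add: mult_ac)
    then have "?b + J1 + J2 \<le> - \<gamma> * (norm (x t))\<^sup>2"
      by (rule mult_left_le_imp_le) (rule \<tau>(1))
    moreover have "?H \<ge> 0" by (rule Xi2_double_integral_nonneg[OF \<open>h' \<in> Xi2 d\<close> y])
    moreover have H: "?H = integral {-\<tau>..0} (\<lambda>\<theta>. integral {-\<tau>..0} (\<lambda>\<omega>.
           deriv (\<lambda>s. h (?y \<theta>) (?y \<omega>) s \<omega>) \<theta> + deriv (\<lambda>s. h (?y \<theta>) (?y \<omega>) \<theta> s) \<omega>))"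
      by (intro integral_cong h'_eq)
    ultimately have "?b + J1 + (J2 - ?H) \<le> - \<gamma> * (norm (x t))\<^sup>2"
      by simp
    moreover have "((\<lambda>s. lyapunov \<tau> g h (\<lambda>\<theta>. x (s + \<theta>))) has_real_derivative
        (?b + J1 + (J2 - ?H))) (at t within {0..})"
      using DERIV_add[OF D1 D2] unfolding lyapunov_def H by simp
    ultimately show "\<exists>D. ((\<lambda>s. lyapunov \<tau> g h (\<lambda>\<theta>. x (s + \<theta>))) has_real_derivative D) (at t within {0..}) \<and>
        D \<le> - \<gamma> * (norm (x t))\<^sup>2" by blast
  qed (use \<tau> \<open>\<alpha> > 0\<close> \<open>\<gamma> > 0\<close> assms(2) in auto)
qed

end
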